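(* For $k\in\mathbb{R}$ let $\Sigma_k$ be the set of holomorphic functions $f$ on the upper half plane satisfying some monic MLDE of weight $k$. Then for all $k,l\in\mathbb{R}$: (1) $\Sigma_k\subset\Sigma_{k-1}$; (2) $(\log q)\Sigma_k\subset\Sigma_{k-1}$; (3) $E_2\Sigma_k\subset\Sigma_{k+1}$; (4) if $k-l\in\mathbb{Z}$, then $\Sigma_k+\Sigma_l\subset\Sigma_{\min\{k,l\}}$.
   Context: $q=e^{2\pi iz}$ and $\log q=2\pi iz$ for $z$ in the upper half plane; $f'=\frac{1}{2\pi i}\frac{df}{dz}$; $E_2,E_4,E_6$ are the Eisenstein series with constant term $1$, and $\mathcal{M}_w$ is the space of holomorphic modular forms of weight $w$ on $\mathrm{SL}(2,\mathbb{Z})$. For $k\in\mathbb{R}$, $D_kf=f'-\frac{k}{12}E_2f$, $D_k^{(0)}=\mathrm{id}$, $D_k^{(j)}=D_{k+2j-2}\circ\cdots\circ D_k$. A monic MLDE of weight $k$ (and order $n\ge0$) is an equation $(D_k^{(n)}+g_1D_k^{(n-1)}+\cdots+g_n)f=0$ with $g_i\in\mathcal{M}_{2i}$. $(\log q)\Sigma_k=\{(\log q)f: f\in\Sigma_k\}$, $E_2\Sigma_k=\{E_2f:f\in\Sigma_k\}$. *)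

theory Defs
  imports "HOL-Complex_Analysis.Complex_Analysis"
begin

definition uhp :: "complex set" where
  "uhp = {z. Im z > 0}"

definition qpar :: "complex \<Rightarrow> complex" where
  "qpar z = exp (2 * of_real pi * \<i> * z)"

definition divsum :: "nat \<Rightarrow> nat \<Rightarrow> nat" where
  "divsum j n = (\<Sum>d\<in>{d. d dvd n}. d ^ j)"

definition E2 :: "complex \<Rightarrow> complex" where
  "E2 z = 1 - 24 * (\<Sum>n. of_nat (divsum 1 (Suc n)) * qpar z ^ Suc n)"

definition modular_forms :: "nat \<Rightarrow> (complex \<Rightarrow> complex) set" where
  "modular_forms w = {f. f holomorphic_on uhp \<and>
     (\<forall>a b c d :: int. a * d - b * c = 1 \<longrightarrow>
        (\<forall>z\<in>uhp. f ((of_int a * z + of_int b) / (of_int c * z + of_int d))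
                   = (of_int c * z + of_int d) ^ w * f z)) \<and>
     (\<exists>B. \<forall>z. 1 \<le> Im z \<longrightarrow> norm (f z) \<le> B)}"

definition qderiv :: "(complex \<Rightarrow> complex) \<Rightarrow> complex \<Rightarrow> complex" where
  "qderiv f z = deriv f z / (2 * of_real pi * \<i>)"

definition Dop :: "real \<Rightarrow> (complex \<Rightarrow> complex) \<Rightarrow> complex \<Rightarrow> complex" where
  "Dop k f = (\<lambda>z. qderiv f z - of_real (k / 12) * E2 z * f z)"

fun Diter :: "real \<Rightarrow> nat \<Rightarrow> (complex \<Rightarrow> complex) \<Rightarrow> complex \<Rightarrow> complex" where
  "Diter k 0 f = f"
| "Diter k (Suc j) f = Dop (k + 2 * real j) (Diter k j f)"

definition satisfies_monic_MLDE :: "real \<Rightarrow> (complex \<Rightarrow> complex) \<Rightarrow> bool" where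
  "satisfies_monic_MLDE k f \<longleftrightarrow>
     (\<exists>n::nat. \<exists>g :: nat \<Rightarrow> complex \<Rightarrow> complex.
        (\<forall>i\<in>{1..n}. g i \<in> modular_forms (2 * i)) \<and>
        (\<forall>z\<in>uhp. Diter k n f z + (\<Sum>i=1..n. g i z * Diter k (n - i) f z) = 0))"

definition Sigma_set :: "real \<Rightarrow> (complex \<Rightarrow> complex) set" where
  "Sigma_set k = {f. f holomorphic_on uhp \<and> satisfies_monic_MLDE k f}"

end

theory Submission
  imports Defs
begin

text \<open>
  The rules \<open>D\<^sub>k\<^sub>+\<^sub>l (f g) = D\<^sub>k f g + f D\<^sub>l g\<close> and \<open>D\<^sub>1 E\<^sub>2 = - E\<^sub>4 / 12\<close> show that, for a solution \<open>f\<close> of a monic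
  MLDE, the functions \<open>f\<close>, \<open>(log q) f\<close>, \<open>E\<^sub>2 f\<close> and the sums in (4) all lie in a finitely generated
  graded module over the ring of modular forms that is stable under the operators \<open>D\<close>. That ring is
  Noetherian, so some iterate \<open>D\<^sup>m F\<close> of an element \<open>F\<close> of such a module is a combination of the
  previous ones, and this is a monic MLDE for \<open>F\<close>.

  The Noetherian property comes from leading terms at the cusp: a nonzero form of weight \<open>2n\<close> is
  \<open>\<Delta>\<^sup>v g\<close> with \<open>g\<close> nonzero at the cusp, the pairs \<open>(v, n - 6 v)\<close> satisfy Dickson's lemma, and
  monomials in \<open>\<Delta>\<close>, \<open>E\<^sub>4\<close>, \<open>E\<^sub>6\<close> allow one to cancel leading terms. Division by \<open>\<Delta>\<close> needs that \<open>\<Delta>\<close> has no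
  zeros, which follows from \<open>D\<^sub>1\<^sub>2 \<Delta> = 0\<close>, and that there are no cusp forms of weight at most 10. Modularity
  of \<open>E\<^sub>4 = E\<^sub>2\<^sup>2 - 12 E\<^sub>2'\<close> and \<open>E\<^sub>6 = - 3 D\<^sub>4 E\<^sub>4\<close> is inherited from the quasimodularity of \<open>E\<^sub>2\<close>.
\<close>

section \<open>Partial fractions from the reflection formula\<close>

text \<open>Linear algebra over the field of meromorphic modular functions would also relate the
  iterates of \<open>F\<close>, but with poles in the coefficients. A monic equation with
  holomorphic coefficients asks for finiteness over the ring of modular forms itself, hence the
  Noetherian property. The weight shifts come from giving the constant 1 the weight -1: its Serre
  derivative \<open>E2 / 12\<close> then has weight 1, and a further derivative leads back to a
  multiple of \<open>E4\<close>. So \<open>1 * f\<close> has weight \<open>k - 1\<close> and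
  \<open>E2 * f\<close> has weight \<open>k + 1\<close>. As \<open>log q\<close> behaves like 1
  here, (1), (2) and (3) are instances of one statement about a pair of functions, and (4) is
  reduced by (1) to equal weights. The analytic obstacle is the behaviour of \<open>E2\<close> under
  the inversion. \<open>E2\<close> is given by a series in \<open>q\<close>, which partial fractions
  turn into a lattice sum; that sum depends on the order of summation, and exchanging the order
  produces the non-modular term.\<close>

lemma not_nonpos_Int_reflect:
  fixes z :: complex
  assumes "z \<notin> \<int>"
  shows "z \<notin> \<int>\<^sub>\<le>\<^sub>0" "1 - z \<notin> \<int>\<^sub>\<le>\<^sub>0" "sin (of_real pi * z) \<noteq> 0"
proof -
  show "z \<notin> \<int>\<^sub>\<le>\<^sub>0" using assms nonpos_Ints_Int by blast
  show "1 - z \<notin> \<int>\<^sub>\<le>\<^sub>0"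
    using assms by (metis Ints_1 Ints_diff diff_diff_eq2 add_diff_cancel_left' nonpos_Ints_Int)
  show "sin (of_real pi * z) \<noteq> 0"
  proof
    assume "sin (of_real pi * z) = 0"
    then obtain n :: int where "of_real pi * z = of_real (of_int n * pi)"
      by (auto simp: sin_eq_0)
    then have "z = of_int n" by simp
    then show False using assms by simp
  qed
qed

text \<open>Both sides of the reflection formula for \<open>Gamma z * Gamma (1 - z)\<close> are
  differentiated, and the common factor is cancelled.\<close>

lemma Digamma_reflection:
  fixes z :: complex
  assumes "z \<notin> \<int>"
  shows "Digamma (1 - z) - Digamma z = of_real pi * cot (of_real pi * z)"
proof -
  note nz = not_nonpos_Int_reflect[OF assms]
  have "((\<lambda>z. Gamma z * Gamma (1 - z)) has_field_derivative
      Gamma z * Gamma (1 - z) * (Digamma z - Digamma (1 - z))) (at z)"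
    by (rule derivative_eq_intros nz refl | simp add: nz algebra_simps)+
  moreover have "((\<lambda>z. of_real pi / sin (of_real pi * z)) has_field_derivative
      - (of_real pi * (of_real pi * cos (of_real pi * z))) / (sin (of_real pi * z))^2) (at z)"
    using nz by (auto intro!: derivative_eq_intros simp: power2_eq_square)
  ultimately have "Gamma z * Gamma (1 - z) * (Digamma z - Digamma (1 - z)) =
      - (of_real pi * (of_real pi * cos (of_real pi * z))) / (sin (of_real pi * z))^2"
    unfolding Gamma_reflection_complex using DERIV_unique by blast
  then have "of_real pi / sin (of_real pi * z) * (Digamma z - Digamma (1 - z)) =
      - (of_real pi * (of_real pi * cos (of_real pi * z))) / (sin (of_real pi * z))^2"
    by (simp add: Gamma_reflection_complex)
  then have "of_real pi * (Digamma z - Digamma (1 - z)) * sin (of_real pi * z) =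
      - (of_real pi * (of_real pi * cos (of_real pi * z)))"
    using nz(3) by (simp add: power2_eq_square nonzero_divide_eq_eq nonzero_eq_divide_eq del: mult_cancel_left mult_minus_right)
  then have "of_real pi * ((Digamma (1 - z) - Digamma z) * sin (of_real pi * z)) =
      of_real pi * (of_real pi * cos (of_real pi * z))"
    by algebra
  then have "(Digamma (1 - z) - Digamma z) * sin (of_real pi * z) = of_real pi * cos (of_real pi * z)"
    by simp
  then show ?thesis using nz by (simp add: cot_def nonzero_eq_divide_eq)
qed

lemma Trigamma_reflection:
  fixes z :: complex
  assumes "z \<notin> \<int>"
  shows "Polygamma 1 z + Polygamma 1 (1 - z) = (of_real pi / sin (of_real pi * z))\<^sup>2"
proof -
  note nz = not_nonpos_Int_reflect[OF assms]
  have op: "open (- \<int> :: complex set)" by (simp add: open_Compl closed_Ints)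
  have "((\<lambda>z. Digamma (1 - z) - Digamma z) has_field_derivative
      - Polygamma 1 (1 - z) - Polygamma 1 z) (at z)"
    using nz by (auto intro!: derivative_eq_intros)
  moreover have "((\<lambda>z. of_real pi * cot (of_real pi * z)) has_field_derivative
      - (of_real pi / sin (of_real pi * z))\<^sup>2) (at z)"
    using nz(3) by (auto intro!: derivative_eq_intros DERIV_chain2[OF DERIV_cot] simp: power_divide divide_inverse power2_eq_square)
  then have "((\<lambda>z. Digamma (1 - z) - Digamma z) has_field_derivative
      - (of_real pi / sin (of_real pi * z))\<^sup>2) (at z)"
    by (rule has_field_derivative_transform_within_open[OF _ op]) (use assms Digamma_reflection in auto)
  ultimately have "- Polygamma 1 (1 - z) - Polygamma 1 z = - (of_real pi / sin (of_real pi * z))\<^sup>2"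
    using DERIV_unique by blast
  then show ?thesis by (simp add: algebra_simps minus_equation_iff)
qed

text \<open>The trigamma series at \<open>w\<close> runs over \<open>w + n\<close> with
  \<open>n >= 0\<close>, the one at \<open>1 - w\<close> over \<open>w - n\<close> with
  \<open>n >= 1\<close>. Together they form the two-sided series, folded by pairing \<open>d\<close>
  with \<open>-d\<close>.\<close>

lemma csc_squared_sums:
  fixes w :: complex
  assumes "w \<notin> \<int>"
  shows "(\<lambda>d. if d = 0 then 1 / w\<^sup>2 else 1 / (w + of_nat d)\<^sup>2 + 1 / (w - of_nat d)\<^sup>2) sums
    (of_real pi / sin (of_real pi * w))\<^sup>2"
proof -
  note nz = not_nonpos_Int_reflect[OF assms]
  have w0: "w \<noteq> 0" "1 - w \<noteq> 0" using assms by auto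
  have A: "(\<lambda>k. inverse ((w + of_nat k)\<^sup>2)) sums Polygamma 1 w"
    using summable_sums[OF Polygamma_converges'[OF w0(1), of 2]]
    by (simp add: Polygamma_def numeral_2_eq_2)
  have B: "(\<lambda>k. inverse ((1 - w + of_nat k)\<^sup>2)) sums Polygamma 1 (1 - w)"
    using summable_sums[OF Polygamma_converges'[OF w0(2), of 2]]
    by (simp add: Polygamma_def numeral_2_eq_2)
  have "(\<lambda>k. if Suc k = 0 then 0 else inverse ((w - of_nat (Suc k))\<^sup>2)) sums Polygamma 1 (1 - w)"
    using B by (rule sums_cong[THEN iffD1, rotated]) (simp add: power2_eq_square algebra_simps)
  then have "(\<lambda>k. if k = 0 then 0 else inverse ((w - of_nat k)\<^sup>2)) sums Polygamma 1 (1 - w)"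
    by (subst (asm) sums_Suc_iff) simp
  from sums_add[OF A this] show ?thesis
    unfolding Trigamma_reflection[OF assms]
    by (rule sums_cong[THEN iffD1, rotated]) (simp add: field_simps)
qed

text \<open>The harmonic terms of the digamma series at \<open>w\<close> and \<open>1 - w\<close>
  cancel in the difference, which is a cotangent by reflection.\<close>

lemma cot_sums:
  fixes w :: complex
  assumes "w \<notin> \<int>"
  shows "(\<lambda>c. 1 / (of_nat (Suc c) - w) - 1 / (of_nat (Suc c) + w)) sums
    (1 / w - of_real pi * cot (of_real pi * w))"
proof -
  have w0: "w \<noteq> 0" "1 - w \<noteq> 0" using assms by auto
  have A: "(\<lambda>k. inverse (of_nat (Suc k)) - inverse (w + of_nat k)) sums (Digamma w + euler_mascheroni)"
    using summable_sums[OF summable_Digamma[OF w0(1)]] by (simp add: Digamma_def)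
  have B: "(\<lambda>k. inverse (of_nat (Suc k)) - inverse (1 - w + of_nat k)) sums (Digamma (1 - w) + euler_mascheroni)"
    using summable_sums[OF summable_Digamma[OF w0(2)]] by (simp add: Digamma_def)
  \<comment> \<open>Telescoping replaces \<open>w + k\<close> by \<open>w + k + 1\<close>, so that
    both series are indexed by \<open>Suc c\<close>; it contributes the term
    \<open>1 / w\<close>.\<close>
  have C: "(\<lambda>k. inverse (w + of_nat (Suc k)) - inverse (w + of_nat k)) sums (0 - inverse (w + of_nat 0))"
    by (intro telescope_sums filterlim_compose[OF tendsto_inverse_0]
              tendsto_add_filterlim_at_infinity[OF tendsto_const] tendsto_of_nat)
  have "(Digamma w + euler_mascheroni) - (Digamma (1 - w) + euler_mascheroni) - (0 - inverse (w + of_nat 0))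
      = 1 / w - of_real pi * cot (of_real pi * w)"
    unfolding Digamma_reflection[OF assms, symmetric] by (simp add: field_simps)
  with sums_diff[OF sums_diff[OF A B] C]
  have "(\<lambda>c. (inverse (of_nat (Suc c)) - inverse (w + of_nat c) - (inverse (of_nat (Suc c)) - inverse (1 - w + of_nat c)) -
      (inverse (w + of_nat (Suc c)) - inverse (w + of_nat c)))) sums
    (1 / w - of_real pi * cot (of_real pi * w))" by simp
  then show ?thesis
    by (rule sums_cong[THEN iffD1, rotated]) (simp add: inverse_eq_divide algebra_simps)
qed

section \<open>The inversion formula for \<open>E\<^sub>2\<close>\<close>

lemma uhpD: "z \<in> uhp \<Longrightarrow> Im z > 0" by (simp add: uhp_def)

lemma open_uhp [simp]: "open uhp" and convex_uhp: "convex uhp"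
  unfolding uhp_def by (simp_all add: open_halfspace_Im_gt convex_halfspace_Im_gt)

section \<open>Lambert series and \<open>E2\<close> as a sum of rows\<close>

lemma norm_qpar: "norm (qpar z) = exp (- 2 * pi * Im z)"
  by (simp add: qpar_def)

lemma norm_qpar_less_1: "z \<in> uhp \<Longrightarrow> norm (qpar z) < 1"
  by (simp add: norm_qpar uhp_def)

lemma qpar_nonzero [simp]: "qpar z \<noteq> 0"
  by (simp add: qpar_def)

text \<open>With \<open>e = exp (i pi z)\<close> one has \<open>q = e^2\<close> and
  \<open>2 i sin (pi z) = e - 1 / e\<close>. This turns a term of the Lambert series of
  \<open>E2\<close> into an inverse square of a sine, to which partial fractions apply.\<close>

lemma lambert_term_csc:
  assumes "z \<in> uhp"
  shows "qpar z / (1 - qpar z)\<^sup>2 = - 1 / (2 * sin (of_real pi * z))\<^sup>2"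
proof -
  define e where "e = exp (\<i> * (of_real pi * z))"
  have e: "e \<noteq> 0" by (simp add: e_def)
  have q: "qpar z = e\<^sup>2"
    unfolding qpar_def e_def exp_double[symmetric] by (simp add: algebra_simps)
  have "2 * sin (of_real pi * z) = - \<i> * (e - inverse e)"
    by (simp add: sin_exp_eq e_def exp_minus)
  then have s: "(2 * sin (of_real pi * z))\<^sup>2 = - (e - inverse e)\<^sup>2"
    by (simp add: power_mult_distrib)
  have s2: "(e - inverse e)\<^sup>2 * e\<^sup>2 = (1 - e\<^sup>2)\<^sup>2"
    using e by (simp add: power2_eq_square field_simps)
  have "1 - e\<^sup>2 \<noteq> 0" using norm_qpar_less_1[OF assms] q by auto
  with s2 have "(e - inverse e)\<^sup>2 \<noteq> 0" by (metis mult_zero_left power_zero_numeral zero_eq_power2)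
  with s2 e \<open>1 - e\<^sup>2 \<noteq> 0\<close> show ?thesis unfolding s q by (simp add: field_simps)
qed

lemma divsum_le: "divsum 1 n \<le> n ^ 2"
proof (cases "n = 0")
  case False
  have "divsum 1 n \<le> (\<Sum>d\<in>{1..n}. n)"
    unfolding divsum_def using False
    by (intro order_trans[OF sum_mono2[of "{1..n}" "{d. d dvd n}" "\<lambda>d. d ^ 1"] sum_mono])
       (auto dest: dvd_imp_le dvd_pos_nat intro: Suc_leI)
  then show ?thesis by (simp add: power2_eq_square)
qed (simp add: divsum_def)

lemma summable_divsum:
  fixes w :: "'a :: {real_normed_field, banach}"
  assumes "norm w < 1"
  shows "summable (\<lambda>n. of_nat (divsum 1 (Suc n)) * w ^ n)"
proof (rule summable_comparison_test_ev)
  \<comment> \<open>Differentiating the geometric series twice gives the coefficients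
    \<open>(n + 1) * (n + 2)\<close>, which dominate \<open>(n + 1)^2\<close>.\<close>
  have "summable (\<lambda>n. diffs (diffs (\<lambda>_. 1)) n * x ^ n)" if "norm x < 1" for x :: real
    using that
    by (intro termdiff_converges[where K = 1]) (auto intro: termdiff_converges[where K = 1] summable_geometric)
  from this[of "norm w"] assms have S: "summable (\<lambda>n. real (Suc n) * real (Suc (Suc n)) * norm w ^ n)"
    by (simp add: diffs_def)
  show "summable (\<lambda>n. real (Suc n) ^ 2 * norm w ^ n)"
    by (rule summable_comparison_test'[OF S]) (auto simp: power2_eq_square intro!: mult_mono)
  have "norm (of_nat (divsum 1 (Suc n)) * w ^ n) \<le> real (Suc n) ^ 2 * norm w ^ n" for n
    using of_nat_mono[OF divsum_le[of "Suc n"], where 'a = real]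
    by (simp add: norm_mult norm_power mult_right_mono del: of_nat_Suc)
  then show "\<forall>\<^sub>F n in sequentially. norm (of_nat (divsum 1 (Suc n)) * w ^ n) \<le> real (Suc n) ^ 2 * norm w ^ n"
    by simp
qed

text \<open>A majorant of product form makes the family absolutely summable over all pairs, so both
  iterated sums agree with the unordered sum.\<close>

lemma double_sums_swap:
  fixes A :: "nat \<Rightarrow> nat \<Rightarrow> 'a :: banach"
  assumes "summable a" "summable b" "\<And>c. a c \<ge> 0" "\<And>d. b d \<ge> 0"
    and le: "\<And>c d. norm (A c d) \<le> a c * b d"
  obtains S where "((\<lambda>(c, d). A c d) has_sum S) UNIV"
    "(\<lambda>c. \<Sum>d. A c d) sums S" "(\<lambda>d. \<Sum>c. A c d) sums S"
    "\<And>c. summable (A c)" "\<And>d. summable (\<lambda>c. A c d)"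
proof -
  have ab: "(\<lambda>(c, d). a c * b d) summable_on (UNIV \<times> UNIV)"
  proof (rule summable_on_SigmaI[where g = "\<lambda>c. a c * suminf b"])
    show "((\<lambda>d. case (c, d) of (c, d) \<Rightarrow> a c * b d) has_sum a c * suminf b) UNIV" for c
      using sums_nonneg_imp_has_sum[OF summable_sums[OF assms(2)]] assms(4)
      by (auto intro: has_sum_cmult_right)
    show "(\<lambda>c. a c * suminf b) summable_on UNIV"
      using summable_nonneg_imp_summable_on[OF assms(1,3)] by (rule summable_on_cmult_left)
  qed (use assms in auto)
  then have "(\<lambda>x. norm (case x of (c, d) \<Rightarrow> A c d)) summable_on (UNIV \<times> UNIV)"
    by (rule Infinite_Sum.abs_summable_on_comparison_test') (use le in auto)
  then have sm: "(\<lambda>(c, d). A c d) summable_on (UNIV \<times> UNIV)"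
    by (rule abs_summable_summable)
  then obtain S where S: "((\<lambda>(c, d). A c d) has_sum S) (UNIV \<times> UNIV)"
    using summable_on_def by blast
  have 1: "summable (\<lambda>d. norm (A c d))" for c
    by (rule summable_comparison_test'[OF summable_mult[OF assms(2), of "a c"]]) (use le in auto)
  have 2: "summable (\<lambda>c. norm (A c d))" for d
    by (rule summable_comparison_test'[OF summable_mult2[OF assms(1), of "b d"]]) (use le in auto)
  have S': "((\<lambda>(d, c). A c d) has_sum S) (UNIV \<times> UNIV)"
    using S by (subst (asm) has_sum_swap) simp
  show ?thesis
  proof (rule that)
    show "((\<lambda>(c, d). A c d) has_sum S) UNIV" using S by simp
    show "(\<lambda>c. \<Sum>d. A c d) sums S"
      by (rule has_sum_imp_sums, rule has_sum_SigmaD[OF S])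
         (use 1 in \<open>auto intro: norm_summable_imp_has_sum summable_sums summable_norm_cancel\<close>)
    show "(\<lambda>d. \<Sum>c. A c d) sums S"
      by (rule has_sum_imp_sums, rule has_sum_SigmaD[OF S'])
         (use 2 in \<open>auto intro: norm_summable_imp_has_sum summable_sums summable_norm_cancel\<close>)
  qed (use 1 2 in \<open>auto intro: summable_norm_cancel\<close>)
qed

definition csc2 :: "complex \<Rightarrow> complex" where
  "csc2 w = (of_real pi / sin (of_real pi * w))\<^sup>2"

text \<open>Expanding \<open>x / (1 - x)^2\<close> as the sum of \<open>n * x^n\<close> at
  \<open>x = q^m\<close> gives a double series with terms \<open>n * q^(m n)\<close>. Collecting the
  terms with equal product \<open>m n\<close> produces the divisor sums.\<close>

lemma lambert_sums:
  fixes q :: complex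
  assumes "norm q < 1"
  shows "(\<lambda>m. q ^ Suc m / (1 - q ^ Suc m)\<^sup>2) sums (\<Sum>n. of_nat (divsum 1 (Suc n)) * q ^ Suc n)"
proof -
  define A where "A = (\<lambda>m n. of_nat (Suc n) * q ^ (Suc m * Suc n))"
  have q1: "norm (q ^ Suc m) < 1" for m
    using assms by (simp add: norm_power power_less_one_iff del: power_Suc)
  have row: "A m sums (q ^ Suc m / (1 - q ^ Suc m)\<^sup>2)" for m
    using sums_mult[OF geometric_deriv_sums[OF q1[of m]], of "q ^ Suc m"]
    by (simp add: A_def power_add power_mult algebra_simps del: of_nat_Suc)
  have sb: "summable (\<lambda>n. real (Suc n) * norm q ^ n)"
    using geometric_deriv_sums[of "norm q"] assms sums_summable by auto
  have le: "norm (A m n) \<le> norm q ^ m * (real (Suc n) * norm q ^ n)" for m n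
  proof -
    have "norm q ^ (Suc m * Suc n) \<le> norm q ^ (m + n)"
      using assms by (intro power_decreasing) auto
    then have "real (Suc n) * norm q ^ (Suc m * Suc n) \<le> real (Suc n) * norm q ^ (m + n)"
      by (intro mult_left_mono) auto
    then show ?thesis
      unfolding A_def norm_mult norm_power norm_of_nat power_add by (simp only: mult_ac)
  qed
  obtain S where S: "((\<lambda>(m, n). A m n) has_sum S) UNIV" "(\<lambda>m. \<Sum>n. A m n) sums S"
    by (rule double_sums_swap[of "\<lambda>m. norm q ^ m" "\<lambda>n. real (Suc n) * norm q ^ n" A])
       (use assms sb le in \<open>auto simp del: of_nat_Suc\<close>)
  have "((\<lambda>(N, d). of_nat d * q ^ Suc N) has_sum S) (SIGMA N:UNIV. {d. d dvd Suc N})"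
  proof (subst has_sum_reindex_bij_witness[where g = "\<lambda>(N, d). of_nat d * q ^ Suc N" and
        h = "\<lambda>(m, n). A m n" and T = UNIV and s' = S and
        j = "\<lambda>(N, d). (Suc N div d - 1, d - 1)" and i = "\<lambda>(m, n). (Suc m * Suc n - 1, Suc n)"])
    fix a assume a: "a \<in> (SIGMA N:UNIV. {d. d dvd Suc N})"
    obtain N d where N: "a = (N, d)" "d dvd Suc N" using a by auto
    then obtain e where e: "Suc N = d * e" by (auto elim: dvdE)
    have pos: "d > 0" "e > 0" using e by (auto intro: Nat.gr0I)
    then have "Suc N div d = e" unfolding e by simp
    have "Suc (e - 1) * Suc (d - 1) = Suc N" using pos e by (simp add: mult.commute)
    moreover have "Suc (d - 1) = d" using pos by simp
    ultimately show "(case case a of (N, d) \<Rightarrow> (Suc N div d - 1, d - 1) of (m, n) \<Rightarrow> (Suc m * Suc n - 1, Suc n)) = a"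
      "(case case a of (N, d) \<Rightarrow> (Suc N div d - 1, d - 1) of (m, n) \<Rightarrow> A m n) = (case a of (N, d) \<Rightarrow> of_nat d * q ^ Suc N)"
      unfolding N(1) prod.case \<open>Suc N div d = e\<close> A_def by (simp_all only: diff_Suc_1)
  next
    fix b :: "nat \<times> nat"
    obtain m n where b: "b = (m, n)" by fastforce
    have "Suc (Suc m * Suc n - 1) = Suc m * Suc n" by simp
    then show "(case case b of (m, n) \<Rightarrow> (Suc m * Suc n - 1, Suc n) of (N, d) \<Rightarrow> (Suc N div d - 1, d - 1)) = b"
      "(case b of (m, n) \<Rightarrow> (Suc m * Suc n - 1, Suc n)) \<in> (SIGMA N:UNIV. {d. d dvd Suc N})"
      using b by (simp_all del: mult_Suc mult_Suc_right)
  qed (use S in auto)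
  then have "(\<lambda>N. of_nat (divsum 1 (Suc N)) * q ^ Suc N) sums S"
    by (intro has_sum_imp_sums, elim has_sum_SigmaD)
       (simp add: divsum_def sum_distrib_right del: power_Suc)
  then show ?thesis
    using S(2) row by (simp add: sums_iff)
qed

text \<open>By partial fractions \<open>csc2 (m z)\<close> is the sum of one row
  \<open>1 / (m z + d)^2\<close>, with \<open>d\<close> over all integers, so \<open>E2\<close> is
  the lattice sum taken row by row. The factor \<open>pi^2 / 6\<close> is zeta(2), and
  \<open>-24 * pi^2 / 6 = -4 * pi^2\<close>.\<close>

lemma E2_csc2_sums:
  assumes "z \<in> uhp"
  shows "(\<lambda>m. csc2 (of_nat (Suc m) * z)) sums (of_real pi ^ 2 / 6 * (E2 z - 1))"
proof -
  have "csc2 (of_nat (Suc m) * z) = - 4 * of_real pi ^ 2 * (qpar z ^ Suc m / (1 - qpar z ^ Suc m)\<^sup>2)" for m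
  proof -
    have "of_nat (Suc m) * z \<in> uhp" using assms by (simp add: uhp_def del: of_nat_Suc)
    moreover have "qpar (of_nat (Suc m) * z) = qpar z ^ Suc m"
      unfolding qpar_def exp_of_nat_mult[symmetric] by (simp add: mult_ac del: of_nat_Suc)
    ultimately have "qpar z ^ Suc m / (1 - qpar z ^ Suc m)\<^sup>2 = - 1 / (2 * sin (of_real pi * (of_nat (Suc m) * z)))\<^sup>2"
      using lambert_term_csc by metis
    then show ?thesis
      by (simp only: csc2_def power_divide power_mult_distrib) simp
  qed
  moreover have "of_real pi ^ 2 / 6 * (E2 z - 1) = - 4 * of_real pi ^ 2 * (\<Sum>n. of_nat (divsum 1 (Suc n)) * qpar z ^ Suc n)"
    by (simp add: E2_def del: power_Suc)
  ultimately show ?thesis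
    using sums_mult[OF lambert_sums[OF norm_qpar_less_1[OF assms]]] by presburger
qed

section \<open>Lattice estimates\<close>

lemma lattice_lower_bound:
  assumes "z \<in> uhp"
  obtains \<delta> where "\<delta> > 0" "\<And>a b :: real. \<delta> * (a\<^sup>2 + b\<^sup>2) \<le> (norm (of_real a * z + of_real b))\<^sup>2"
proof -
  define y where "y = Im z"
  \<comment> \<open>For \<open>p = a z + b\<close> the imaginary part bounds \<open>a\<close> by
    \<open>norm p / y\<close>, and then \<open>b\<close> is at most
    \<open>norm p * (1 + norm z / y)\<close>; \<open>K\<close> adds the squares of both
    factors.\<close>
  define K where "K = 1 / y ^ 2 + (1 + norm z / y) ^ 2"
  have y: "y > 0" using assms by (simp add: y_def uhp_def)
  have K: "K > 0" using y by (simp add: K_def add_pos_nonneg)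
  have "a\<^sup>2 + b\<^sup>2 \<le> K * (norm (of_real a * z + of_real b))\<^sup>2" for a b :: real
  proof -
    define p where "p = of_real a * z + of_real b"
    have "\<bar>Im p\<bar> \<le> norm p" by (rule abs_Im_le_cmod)
    then have a: "\<bar>a\<bar> \<le> norm p / y" using y by (simp add: p_def y_def abs_mult field_simps)
    have "\<bar>b\<bar> = norm (p - of_real a * z)" by (simp add: p_def)
    also have "\<dots> \<le> norm p + \<bar>a\<bar> * norm z"
      using norm_triangle_ineq4[of p "of_real a * z"] by (simp add: norm_mult)
    also have "\<dots> \<le> norm p + norm p / y * norm z"
      using a by (intro add_left_mono mult_right_mono) auto
    finally have b: "\<bar>b\<bar> \<le> norm p * (1 + norm z / y)" by (simp add: algebra_simps)
    have "a\<^sup>2 + b\<^sup>2 \<le> (norm p / y)\<^sup>2 + (norm p * (1 + norm z / y))\<^sup>2"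
      using power_mono[OF a, of 2] power_mono[OF b, of 2] by simp
    also have "\<dots> = K * (norm p)\<^sup>2"
      unfolding K_def power_divide power_mult_distrib by (simp add: distrib_right)
    finally show ?thesis by (simp add: p_def)
  qed
  then show ?thesis
    using K by (intro that[of "1 / K"]) (auto simp: field_simps)
qed

text \<open>The difference equals \<open>-1 / (p^2 * (p^2 - 1))\<close> and so decays like the
  fourth power of \<open>p\<close>, while \<open>(a^2 + b^2)^2 >= a^2 * (1 + b^2)\<close> for
  \<open>a >= 1\<close>. The bound is a product of a function of \<open>a\<close> and one of
  \<open>b\<close>, the form required by \<open>double_sums_swap\<close>.\<close>

lemma lattice_term_bound:
  assumes "z \<in> uhp"
  obtains K where "K \<ge> 0" "\<And>a b :: real. a \<ge> 1 \<Longrightarrow>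
     norm (1 / (of_real a * z + of_real b)\<^sup>2 - 1 / ((of_real a * z + of_real b)\<^sup>2 - 1)) \<le> K * (1 / a\<^sup>2 * (1 / (1 + b\<^sup>2)))"
proof -
  define y where "y = Im z"
  have y: "y > 0" using assms by (simp add: y_def uhp_def)
  obtain \<delta> where d: "\<delta> > 0" "\<And>a b :: real. \<delta> * (a\<^sup>2 + b\<^sup>2) \<le> (norm (of_real a * z + of_real b))\<^sup>2"
    using lattice_lower_bound[OF assms] by metis
  \<comment> \<open>Chosen so that \<open>norm p <= norm (p + e) + 1 <= L * norm (p + e)\<close> for
    \<open>e = 1\<close> and \<open>e = -1\<close>, because \<open>p + e\<close> has imaginary part
    at least \<open>y\<close>.\<close>
  define L where "L = 1 + 1 / y"
  have L: "L > 0" using y by (simp add: L_def add_pos_pos)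
  have "norm (1 / (of_real a * z + of_real b)\<^sup>2 - 1 / ((of_real a * z + of_real b)\<^sup>2 - 1)) \<le> (L\<^sup>2 / \<delta>\<^sup>2) * (1 / a\<^sup>2 * (1 / (1 + b\<^sup>2)))"
    if a: "a \<ge> 1" for a b :: real
  proof -
    define p where "p = of_real a * z + of_real b"
    have "y \<le> a * y" using a y by simp
    then have imp: "Im p \<ge> y" by (simp add: p_def y_def)
    have s: "norm p \<le> L * norm (p + e)" if "e \<in> {1, -1}" for e
    proof -
      have "norm p = norm ((p + e) - e)" by simp
      also have "\<dots> \<le> norm (p + e) + norm e" by (rule norm_triangle_ineq4)
      also have "norm e = 1" using that by auto
      finally have "norm p \<le> norm (p + e) + 1" .
      moreover have "Im (p + e) \<ge> y" using imp that by auto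
      then have "norm (p + e) \<ge> y" using abs_Im_le_cmod[of "p + e"] by linarith
      then have "1 \<le> norm (p + e) / y" using y by simp
      ultimately show ?thesis unfolding L_def by (simp add: algebra_simps)
    qed
    have np: "norm p > 0" using imp y by auto
    have "norm p * norm p \<le> (L * norm (p + 1)) * (L * norm (p + -1))"
      using s[of 1] s[of "-1"] by (intro mult_mono) (use np L in auto)
    also have "\<dots> = L\<^sup>2 * norm ((p + 1) * (p + -1))" by (simp add: norm_mult power2_eq_square)
    also have "(p + 1) * (p + -1) = p\<^sup>2 - 1" by (simp add: power2_eq_square algebra_simps)
    finally have A: "(norm p)\<^sup>2 \<le> L\<^sup>2 * norm (p\<^sup>2 - 1)" by (simp add: power2_eq_square)
    then have n0: "norm (p\<^sup>2 - 1) > 0" using np L by (smt (verit) mult_eq_0_iff norm_ge_zero zero_less_power)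
    have "\<delta>\<^sup>2 * (a\<^sup>2 * (1 + b\<^sup>2)) \<le> \<delta>\<^sup>2 * ((a\<^sup>2 + b\<^sup>2) * (a\<^sup>2 + b\<^sup>2))"
      using a by (intro mult_left_mono mult_mono) (auto simp: add_mono)
    also have "\<dots> = (\<delta> * (a\<^sup>2 + b\<^sup>2)) * (\<delta> * (a\<^sup>2 + b\<^sup>2))" by (simp add: power2_eq_square)
    also have "\<dots> \<le> (norm p)\<^sup>2 * (norm p)\<^sup>2"
      using d by (intro mult_mono) (auto simp: p_def)
    also have "\<dots> \<le> (norm p)\<^sup>2 * (L\<^sup>2 * norm (p\<^sup>2 - 1))" using A by (intro mult_left_mono) auto
    finally have B: "\<delta>\<^sup>2 * (a\<^sup>2 * (1 + b\<^sup>2)) \<le> L\<^sup>2 * ((norm p)\<^sup>2 * norm (p\<^sup>2 - 1))" by (simp only: mult_ac)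
    have "1 / p\<^sup>2 - 1 / (p\<^sup>2 - 1) = - 1 / (p\<^sup>2 * (p\<^sup>2 - 1))"
      using np n0 by (simp add: field_simps)
    then have "norm (1 / p\<^sup>2 - 1 / (p\<^sup>2 - 1)) = 1 / ((norm p)\<^sup>2 * norm (p\<^sup>2 - 1))"
      by (simp add: norm_divide norm_mult norm_power)
    also have "\<dots> \<le> L\<^sup>2 / (\<delta>\<^sup>2 * (a\<^sup>2 * (1 + b\<^sup>2)))"
      using B np n0 d(1) a by (simp add: divide_simps add_pos_nonneg)
    finally show ?thesis by (simp add: p_def)
  qed
  moreover have "L\<^sup>2 / \<delta>\<^sup>2 \<ge> 0" by simp
  ultimately show ?thesis using that by blast
qed

lemma csc2_minus [simp]: "csc2 (- w) = csc2 w"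
  by (simp add: csc2_def)

lemma uhp_not_Int: "z \<in> uhp \<Longrightarrow> z \<notin> \<int>"
  by (auto simp: uhp_def elim!: Ints_cases)

lemma uhp_inverse: "z \<in> uhp \<Longrightarrow> - 1 / z \<in> uhp"
  by (auto simp: uhp_def Im_divide sum_power2_gt_zero_iff)

lemma uhp_inverse_not_Int:
  assumes "z \<in> uhp" "d > 0" shows "of_nat d / z \<notin> \<int>"
proof
  assume "of_nat d / z \<in> \<int>"
  then have "- (of_nat d / z) \<in> \<int>" by simp
  moreover have "- (of_nat d / z) = of_nat d * (- 1 / z)" by simp
  moreover have "of_nat d * (- 1 / z) \<in> uhp"
  proof -
    have "of_nat d * w \<in> uhp" if "w \<in> uhp" for w using that assms(2) by (simp add: uhp_def)
    then show ?thesis using uhp_inverse[OF assms(1)] by blast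
  qed
  ultimately show False using uhp_not_Int by metis
qed

text \<open>The points \<open>N / z\<close> go to infinity in the lower half plane, where the
  cotangent tends to \<open>i\<close>. This limit is the source of the non-modular term of
  \<open>E2\<close>.\<close>

lemma cot_divide_uhp_tendsto:
  assumes "z \<in> uhp"
  shows "(\<lambda>N. cot (of_real pi * (of_nat N / z))) \<longlonglongrightarrow> \<i>"
proof -
  define Q where "Q = qpar (- 1 / z)"
  have Q: "norm Q < 1" unfolding Q_def using uhp_inverse[OF assms] by (rule norm_qpar_less_1)
  have eq: "cot (of_real pi * (of_nat N / z)) = \<i> * (1 + 2 * Q ^ N / (1 - Q ^ N))" if N: "N > 0" for N
  proof -
    define x where "x = of_real pi * (of_nat N / z)"
    define e where "e = exp (\<i> * x)"
    have e0: "e \<noteq> 0" by (simp add: e_def)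
    have "Q ^ N = exp (- 2 * \<i> * x)"
      unfolding Q_def qpar_def exp_of_nat_mult[symmetric] x_def by (simp add: field_simps)
    also have "\<dots> = inverse (e ^ 2)"
      unfolding e_def exp_double[symmetric] exp_minus[symmetric] by (simp add: mult.assoc)
    finally have QN: "Q ^ N = inverse (e ^ 2)" .
    have "norm (Q ^ N) < 1" using Q N by (simp add: norm_power power_less_one_iff)
    then have "inverse (e^2) \<noteq> 1" unfolding QN by auto
    then have ne: "e\<^sup>2 \<noteq> 1" by auto
    have "cot x = \<i> * (e + inverse e) / (e - inverse e)"
    proof -
      have "cos x = (e + inverse e) / 2" "sin x = (e - inverse e) / (2 * \<i>)"
        by (simp_all add: sin_exp_eq cos_exp_eq e_def exp_minus)
      then have "cot x = (e + inverse e) / 2 * (2 * \<i>) / (e - inverse e)" by (simp only: cot_def divide_divide_eq_right)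
      then show ?thesis by (simp add: mult.commute)
    qed
    also have "\<dots> = \<i> * (e\<^sup>2 + 1) / (e\<^sup>2 - 1)"
    proof -
      have "e + inverse e = (e\<^sup>2 + 1) / e" "e - inverse e = (e\<^sup>2 - 1) / e"
        using e0 by (simp_all add: power2_eq_square field_simps)
      then show ?thesis using e0 by simp
    qed
    also have "\<dots> = \<i> * (1 + 2 * inverse (e\<^sup>2) / (1 - inverse (e\<^sup>2)))"
      using e0 ne by (simp add: field_simps)
    finally show ?thesis by (simp add: QN x_def)
  qed
  have "\<forall>\<^sub>F N in sequentially. \<i> * (1 + 2 * Q ^ N / (1 - Q ^ N)) = cot (of_real pi * (of_nat N / z))"
    using eventually_gt_at_top[of 0] by eventually_elim (rule eq[symmetric])
  moreover have "(\<lambda>N. \<i> * (1 + 2 * Q ^ N / (1 - Q ^ N))) \<longlonglongrightarrow> \<i> * (1 + 2 * 0 / (1 - 0))"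
    by (intro tendsto_intros LIMSEQ_power_zero Q) auto
  ultimately show "(\<lambda>N. cot (of_real pi * (of_nat N / z))) \<longlonglongrightarrow> \<i>"
    using Lim_transform_eventually by fastforce
qed

text \<open>Partial fractions give \<open>1 / (y^2 - 1) = (1 / (y - 1) - 1 / (y + 1)) / 2\<close>.
  The two poles differ by 2, so a symmetric sum leaves two terms at each end.\<close>

lemma telescope_pairs:
  fixes x :: complex
  assumes "Im x \<noteq> 0"
  shows "(\<Sum>d\<le>N. if d = 0 then 1 / (x\<^sup>2 - 1) else 1 / ((x + of_nat d)\<^sup>2 - 1) + 1 / ((x - of_nat d)\<^sup>2 - 1)) =
    ((1 / (x - of_nat N) - 1 / (x + of_nat N)) + (1 / (x - of_nat (Suc N)) - 1 / (x + of_nat (Suc N)))) / 2"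
proof -
  have nz: "x + of_int k \<noteq> 0" for k :: int
    using assms by (auto simp: complex_eq_iff)
  have pf: "1 / ((x + of_int k)\<^sup>2 - 1) = (1 / (x + of_int (k - 1)) - 1 / (x + of_int (k + 1))) / 2" for k :: int
  proof -
    have "(x + of_int k)\<^sup>2 - 1 = (x + of_int (k - 1)) * (x + of_int (k + 1))"
      by (simp add: power2_eq_square algebra_simps)
    moreover have "1 / (a * b) = (1 / a - 1 / b) / 2" if "a \<noteq> 0" "b \<noteq> 0" "b - a = 2" for a b :: complex
      using that by (simp add: divide_simps)
    ultimately show ?thesis using nz[of "k - 1"] nz[of "k + 1"] by simp
  qed
  show ?thesis
  proof (induction N)
    case 0
    show ?case using pf[of 0] by simp
  next
    case (Suc N)
    have idx: "(x + of_nat (Suc N))\<^sup>2 = (x + of_int (int N + 1))\<^sup>2" "(x - of_nat (Suc N))\<^sup>2 = (x + of_int (- int N - 1))\<^sup>2"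
      by (simp_all add: algebra_simps)
    have idx': "x + of_int (int N + 1 - 1) = x + of_nat N" "x + of_int (int N + 1 + 1) = x + of_nat (Suc (Suc N))"
      "x + of_int (- int N - 1 - 1) = x - of_nat (Suc (Suc N))" "x + of_int (- int N - 1 + 1) = x - of_nat N"
      by simp_all
    have "((u1 - u2) + (v1 - v2)) / 2 + ((u2 - w2) / 2 + (w1 - u1) / 2) = ((v1 - v2) + (w1 - w2)) / 2"
      for u1 u2 v1 v2 w1 w2 :: complex
      by (simp add: field_simps)
    then show ?case
      unfolding sum.atMost_Suc Suc idx pf idx' by (simp only: nat.simps if_False)
  qed
qed

text \<open>The double series for \<open>E\<^sub>2\<close> is only conditionally convergent. With \<open>x = (c + 1) z + d\<close>, the terms
  \<open>1 / (x\<^sup>2 - 1)\<close> telescope in \<open>d\<close>, and subtracting them from \<open>1 / x\<^sup>2\<close> makes the sum absolutely convergent.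
  The correction term is thus the limit of the sums of \<open>1 / (x\<^sup>2 - 1)\<close> over all \<open>c\<close> and \<open>\<bar>d\<bar> \<le> N\<close>.\<close>

lemma E2_inversion:
  assumes z: "z \<in> uhp"
  shows "E2 (- 1 / z) = z\<^sup>2 * E2 z - 6 * \<i> / of_real pi * z"
proof -
  define x where "x = (\<lambda>c. of_nat (Suc c) * z)"
  define F where "F = (\<lambda>c d. if d = 0 then 1 / (x c)\<^sup>2 else 1 / (x c + of_nat d)\<^sup>2 + 1 / (x c - of_nat d)\<^sup>2)"
  define G where "G = (\<lambda>c d. if d = 0 then 1 / ((x c)\<^sup>2 - 1) else 1 / ((x c + of_nat d)\<^sup>2 - 1) + 1 / ((x c - of_nat d)\<^sup>2 - 1))"
  define A where "A = (\<lambda>c d. F c d - G c d)"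
  define \<zeta> where "\<zeta> = complex_of_real (pi ^ 2 / 6)"
  \<comment> \<open>The sum over \<open>c\<close> of the boundary terms
    \<open>1 / (x c - N) - 1 / (x c + N)\<close>, evaluated by \<open>cot_sums\<close> at
    \<open>N / z\<close>.\<close>
  define H where "H = (\<lambda>N. (1 / (of_nat N / z) - of_real pi * cot (of_real pi * (of_nat N / z))) / z)"
  have z0: "z \<noteq> 0" using z by (auto simp: uhp_def)
  have x_uhp: "x c \<in> uhp" for c using z by (simp add: x_def uhp_def del: of_nat_Suc)
  have Im_x: "Im (x c) \<noteq> 0" for c using x_uhp[of c] by (simp add: uhp_def)
  have F_row: "F c sums csc2 (x c)" for c
    unfolding F_def csc2_def by (rule csc_squared_sums[OF uhp_not_Int[OF x_uhp]])
  \<comment> \<open>The boundary terms vanish in the limit: subtracting \<open>G\<close> changes no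
    row sum, only the sums by columns.\<close>
  have G_row: "G c sums 0" for c
  proof -
    have lim: "(\<lambda>N. 1 / (x c + e * of_nat N)) \<longlonglongrightarrow> 0" if "e \<in> {1, -1}" for e
    proof (rule tendsto_divide_0[OF tendsto_const])
      have "filterlim (\<lambda>N. e * of_nat N :: complex) at_infinity sequentially"
        using that by (intro tendsto_mult_filterlim_at_infinity[OF tendsto_const] tendsto_of_nat) auto
      then show "filterlim (\<lambda>N. x c + e * of_nat N) at_infinity sequentially"
        by (rule tendsto_add_filterlim_at_infinity[OF tendsto_const])
    qed
    note l = lim[of 1, simplified] lim[of "-1", simplified]
    note l = l LIMSEQ_Suc[OF l(1)] LIMSEQ_Suc[OF l(2)]
    have "(\<lambda>N. ((1 / (x c - of_nat N) - 1 / (x c + of_nat N)) +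
        (1 / (x c - of_nat (Suc N)) - 1 / (x c + of_nat (Suc N)))) / 2) \<longlonglongrightarrow> ((0 - 0) + (0 - 0)) / 2"
      by (intro tendsto_divide tendsto_add tendsto_diff l tendsto_const) simp
    then show ?thesis
      unfolding sums_def_le G_def telescope_pairs[OF Im_x] by simp
  qed
  have A_row: "A c sums csc2 (x c)" for c
    using sums_diff[OF F_row G_row] by (simp add: A_def)
  obtain K where K: "K \<ge> 0" "\<And>a b :: real. a \<ge> 1 \<Longrightarrow>
     norm (1 / (of_real a * z + of_real b)\<^sup>2 - 1 / ((of_real a * z + of_real b)\<^sup>2 - 1)) \<le> K * (1 / a\<^sup>2 * (1 / (1 + b\<^sup>2)))"
    using lattice_term_bound[OF z] by blast
  have A_le: "norm (A c d) \<le> (1 / real (Suc c) ^ 2) * (2 * K * (1 / (1 + real d ^ 2)))" for c d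
  proof (cases "d = 0")
    case True
    have "norm (A c d) \<le> K * (1 / real (Suc c) ^ 2 * (1 / (1 + 0\<^sup>2)))"
      using K(2)[of "real (Suc c)" 0] True by (simp add: A_def F_def G_def x_def)
    also have "\<dots> \<le> 2 * K * (1 / real (Suc c) ^ 2 * (1 / (1 + 0\<^sup>2)))"
      using K(1) by (intro mult_right_mono) auto
    finally show ?thesis using True by simp
  next
    case False
    have "A c d = (1 / (x c + of_nat d)\<^sup>2 - 1 / ((x c + of_nat d)\<^sup>2 - 1)) + (1 / (x c - of_nat d)\<^sup>2 - 1 / ((x c - of_nat d)\<^sup>2 - 1))"
      using False by (simp add: A_def F_def G_def)
    then have "norm (A c d) \<le> norm (1 / (x c + of_nat d)\<^sup>2 - 1 / ((x c + of_nat d)\<^sup>2 - 1)) + norm (1 / (x c - of_nat d)\<^sup>2 - 1 / ((x c - of_nat d)\<^sup>2 - 1))"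
      by (metis norm_triangle_ineq)
    also have "\<dots> \<le> K * (1 / real (Suc c) ^ 2 * (1 / (1 + real d ^ 2))) + K * (1 / real (Suc c) ^ 2 * (1 / (1 + real d ^ 2)))"
      using K(2)[of "real (Suc c)" "real d"] K(2)[of "real (Suc c)" "- real d"]
      by (intro add_mono) (simp_all add: x_def)
    finally show ?thesis by (simp add: mult_ac)
  qed
  have sa: "summable (\<lambda>c. 1 / real (Suc c) ^ 2)"
    using inverse_squares_sums sums_summable by (simp add: add.commute)
  have sb: "summable (\<lambda>d. 2 * K * (1 / (1 + real d ^ 2)))"
  proof (intro summable_mult, rule summable_comparison_test'[OF summable_mult[OF sa, of 2]])
    fix d :: nat
    have "(real d - 1) ^ 2 \<ge> 0" by simp
    then have "real (Suc d) ^ 2 \<le> 2 * (1 + real d ^ 2)" by (simp add: power2_eq_square algebra_simps)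
    then show "norm (1 / (1 + real d ^ 2)) \<le> 2 * (1 / real (Suc d) ^ 2)"
      by (simp add: field_simps add_pos_nonneg del: of_nat_Suc)
  qed
  obtain S where S: "(\<lambda>c. \<Sum>d. A c d) sums S" "(\<lambda>d. \<Sum>c. A c d) sums S"
      "\<And>d. summable (\<lambda>c. A c d)"
    by (rule double_sums_swap[OF sa sb _ _ A_le]) (use K(1) in auto)
  have "(\<lambda>c. csc2 (x c)) sums S" using S(1) A_row by (simp add: sums_iff)
  then have S_eq: "S = \<zeta> * (E2 z - 1)"
    using E2_csc2_sums[OF z] unfolding x_def \<zeta>_def by (simp add: sums_iff)
  define T where "T = (\<lambda>d. \<Sum>c. A c d)"
  \<comment> \<open>The column sums of \<open>F\<close>. The column of \<open>d > 0\<close> misses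
    the term with row number 0, which is the subtracted \<open>1 / d^2\<close>. As
    \<open>csc2\<close> is even, \<open>d / z\<close> may be replaced by
    \<open>d * (-1 / z)\<close>, which lies in the upper half plane.\<close>
  define f where "f = (\<lambda>d. if d = 0 then \<zeta> / z\<^sup>2 else (csc2 (of_nat d * (- 1 / z)) - z\<^sup>2 / of_nat d ^ 2) / z\<^sup>2)"
  have zeta: "(\<lambda>c. 1 / of_nat (Suc c) ^ 2) sums \<zeta>"
    using sums_of_real[OF inverse_squares_sums, where 'a = complex] by (simp add: \<zeta>_def add.commute)
  have F_col: "(\<lambda>c. F c d) sums f d" for d
  proof (cases "d = 0")
    case True
    then show ?thesis
      using sums_divide[OF zeta, of "z\<^sup>2"] by (simp add: F_def f_def x_def power_mult_distrib)
  next
    case False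
    define w where "w = of_nat d / z"
    have w: "w \<notin> \<int>" using uhp_inverse_not_Int[OF z] False by (simp add: w_def)
    have "(\<lambda>d. if Suc d = 0 then 1 / w\<^sup>2 else 1 / (w + of_nat (Suc d))\<^sup>2 + 1 / (w - of_nat (Suc d))\<^sup>2) sums (csc2 w - 1 / w\<^sup>2)"
      using csc_squared_sums[OF w] by (subst sums_Suc_iff) (simp add: csc2_def)
    then have "(\<lambda>c. (1 / (w + of_nat (Suc c))\<^sup>2 + 1 / (w - of_nat (Suc c))\<^sup>2) / z\<^sup>2) sums ((csc2 w - 1 / w\<^sup>2) / z\<^sup>2)"
      by (intro sums_divide) simp
    moreover have "(1 / (w + of_nat (Suc c))\<^sup>2 + 1 / (w - of_nat (Suc c))\<^sup>2) / z\<^sup>2 = F c d" for c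
    proof -
      have "x c + of_nat d = z * (w + of_nat (Suc c))" "x c - of_nat d = - (z * (w - of_nat (Suc c)))"
        using z0 by (simp_all add: w_def x_def field_simps)
      then show ?thesis using False
        by (simp add: F_def power_mult_distrib add_divide_distrib del: of_nat_Suc) (simp add: mult.commute)
    qed
    moreover have "csc2 w = csc2 (of_nat d * (- 1 / z))"
      using csc2_minus[of w] by (simp add: w_def)
    moreover have "1 / w\<^sup>2 = z\<^sup>2 / of_nat d ^ 2" by (simp add: w_def power_divide)
    ultimately show ?thesis using False by (simp add: f_def)
  qed
  have G_col: "(\<lambda>c. G c d) sums (f d - T d)" for d
    using sums_diff[OF F_col[of d] summable_sums[OF S(3)[of d]]] by (simp add: A_def T_def)
  have H_sums: "(\<lambda>c. 1 / (x c - of_nat N) - 1 / (x c + of_nat N)) sums H N" if "N > 0" for N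
  proof -
    define w where "w = of_nat N / z"
    have w: "w \<notin> \<int>" using uhp_inverse_not_Int[OF z] that by (simp add: w_def)
    have "(1 / (of_nat (Suc c) - w) - 1 / (of_nat (Suc c) + w)) / z = 1 / (x c - of_nat N) - 1 / (x c + of_nat N)" for c
    proof -
      have "x c + of_nat N = z * (of_nat (Suc c) + w)" "x c - of_nat N = z * (of_nat (Suc c) - w)"
        using z0 by (simp_all add: w_def x_def field_simps)
      then show ?thesis by (simp add: diff_divide_distrib mult.commute del: of_nat_Suc)
    qed
    then show ?thesis
      using sums_divide[OF cot_sums[OF w], of z] by (simp add: H_def w_def del: of_nat_Suc)
  qed
  \<comment> \<open>The finite sum over \<open>d\<close> is taken inside the sum over
    \<open>c\<close>, where \<open>G\<close> telescopes to boundary terms at \<open>N\<close> and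
    \<open>N + 1\<close>.\<close>
  have key: "(\<Sum>d\<le>N. f d) - (\<Sum>d\<le>N. T d) = (H N + H (Suc N)) / 2" if N: "N > 0" for N
  proof (rule sums_unique2)
    show "(\<lambda>c. \<Sum>d\<le>N. G c d) sums ((\<Sum>d\<le>N. f d) - (\<Sum>d\<le>N. T d))"
      unfolding sum_subtractf[symmetric] by (intro sums_sum G_col)
    show "(\<lambda>c. \<Sum>d\<le>N. G c d) sums ((H N + H (Suc N)) / 2)"
      unfolding G_def telescope_pairs[OF Im_x]
      by (intro sums_divide sums_add H_sums) (use N in auto)
  qed
  have "(\<lambda>N. (1 / (of_nat N / z) - of_real pi * cot (of_real pi * (of_nat N / z))) / z) \<longlonglongrightarrow> (0 - of_real pi * \<i>) / z"
  proof (intro tendsto_intros cot_divide_uhp_tendsto z z0)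
    have "(\<lambda>N. z * inverse (of_nat N)) \<longlonglongrightarrow> z * 0"
      by (intro tendsto_intros tendsto_compose[OF _ tendsto_inverse_0] lim_inverse_n)
    then show "(\<lambda>N. 1 / (of_nat N / z)) \<longlonglongrightarrow> 0" by (simp add: field_simps)
  qed
  then have Hl: "H \<longlonglongrightarrow> - (of_real pi * \<i> / z)" by (simp add: H_def)
  have lim1: "(\<lambda>N. (H N + H (Suc N)) / 2) \<longlonglongrightarrow> (- (of_real pi * \<i> / z) + - (of_real pi * \<i> / z)) / 2"
    by (intro tendsto_intros LIMSEQ_Suc Hl) simp
  have f_sums: "f sums (\<zeta> / z\<^sup>2 + (\<zeta> * (E2 (- 1 / z) - 1) / z\<^sup>2 - \<zeta>))"
  proof -
    have "(\<lambda>d. csc2 (of_nat (Suc d) * (- 1 / z)) / z\<^sup>2 - 1 / of_nat (Suc d) ^ 2) sums (\<zeta> * (E2 (- 1 / z) - 1) / z\<^sup>2 - \<zeta>)"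
      using sums_diff[OF sums_divide[OF E2_csc2_sums[OF uhp_inverse[OF z]]] zeta]
      by (simp only: \<zeta>_def of_real_power of_real_divide of_real_numeral)
    moreover have "csc2 (of_nat (Suc d) * (- 1 / z)) / z\<^sup>2 - 1 / of_nat (Suc d) ^ 2 = f (Suc d)" for d
      using z0 by (simp add: f_def diff_divide_distrib del: of_nat_Suc)
    ultimately have "(\<lambda>d. f (Suc d)) sums (\<zeta> * (E2 (- 1 / z) - 1) / z\<^sup>2 - \<zeta>)" by simp
    then show ?thesis by (subst (asm) sums_Suc_iff) (simp add: f_def add.commute)
  qed
  have "(\<lambda>N. (\<Sum>d\<le>N. f d) - (\<Sum>d\<le>N. T d)) \<longlonglongrightarrow> (\<zeta> / z\<^sup>2 + (\<zeta> * (E2 (- 1 / z) - 1) / z\<^sup>2 - \<zeta>)) - S"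
    using f_sums S(2) unfolding sums_def_le T_def by (intro tendsto_diff) auto
  then have "(\<lambda>N. (H N + H (Suc N)) / 2) \<longlonglongrightarrow> (\<zeta> / z\<^sup>2 + (\<zeta> * (E2 (- 1 / z) - 1) / z\<^sup>2 - \<zeta>)) - S"
    by (rule Lim_transform_eventually) (rule eventually_mono[OF eventually_gt_at_top[of 0] key])
  then have "(\<zeta> / z\<^sup>2 + (\<zeta> * (E2 (- 1 / z) - 1) / z\<^sup>2 - \<zeta>)) - S = - (of_real pi * \<i> / z)"
    using LIMSEQ_unique[OF _ lim1] by fastforce
  then have "\<zeta> * (E2 (- 1 / z) / z\<^sup>2) = \<zeta> * E2 z - of_real pi * \<i> / z"
    unfolding S_eq by (simp add: algebra_simps diff_divide_distrib)
  moreover have "\<zeta> \<noteq> 0" by (simp add: \<zeta>_def)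
  ultimately have "E2 (- 1 / z) / z\<^sup>2 = E2 z - of_real pi * \<i> / z / \<zeta>"
    by (metis (no_types, lifting) diff_divide_distrib nonzero_mult_div_cancel_left)
  also have "of_real pi * \<i> / z / \<zeta> = 6 * \<i> / of_real pi / z"
    by (simp add: \<zeta>_def field_simps power2_eq_square)
  finally show ?thesis using z0 by (simp add: field_simps power2_eq_square)
qed

section \<open>Quasimodularity and \<open>q\<close>-expansions\<close>

definition mob :: "int \<Rightarrow> int \<Rightarrow> int \<Rightarrow> int \<Rightarrow> complex \<Rightarrow> complex" where
  "mob a b c d z = (of_int a * z + of_int b) / (of_int c * z + of_int d)"

lemma mob_denom_nonzero:
  assumes "a * d - b * c = (1::int)" "z \<in> uhp"
  shows "of_int c * z + of_int d \<noteq> (0::complex)"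
proof
  assume *: "of_int c * z + of_int d = (0::complex)"
  from arg_cong[OF this, of Im] have "c = 0" using assms(2) by (simp add: uhp_def)
  with * assms(1) show False by auto
qed

lemma Im_mob:
  assumes "a * d - b * c = (1::int)" "z \<in> uhp"
  shows "Im (mob a b c d z) = Im z / (norm (of_int c * z + of_int d))\<^sup>2"
proof -
  have "real_of_int (a * d - b * c) = 1" using assms(1) by simp
  then have d: "real_of_int a * real_of_int d = 1 + real_of_int b * real_of_int c" by (simp add: algebra_simps)
  have "(of_int a * Im z) * (of_int c * Re z + of_int d) - (of_int a * Re z + of_int b) * (of_int c * Im z)
     = (real_of_int a * real_of_int d - real_of_int b * real_of_int c) * Im z" by (simp add: algebra_simps)
  also have "\<dots> = Im z" using d by simp
  finally show ?thesis unfolding mob_def Im_divide cmod_power2 by simp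
qed

lemma mob_in_uhp:
  assumes "a * d - b * c = (1::int)" "z \<in> uhp"
  shows "mob a b c d z \<in> uhp"
  using Im_mob[OF assms] mob_denom_nonzero[OF assms] assms(2) by (simp add: uhp_def)

lemma has_field_derivative_mob:
  assumes "a * d - b * c = (1::int)" "z \<in> uhp"
  shows "(mob a b c d has_field_derivative 1 / (of_int c * z + of_int d)\<^sup>2) (at z)"
proof -
  have "complex_of_int (a * d - b * c) = 1" using assms(1) by simp
  then have "of_int a * (of_int c * z + of_int d) - (of_int a * z + of_int b) * of_int c = (1::complex)"
    by (simp add: algebra_simps)
  then show ?thesis
    unfolding mob_def [abs_def] using mob_denom_nonzero[OF assms]
    by (auto intro!: derivative_eq_intros simp: power2_eq_square)
qed

lemma qpar_plus_int: "qpar (z + of_int n) = qpar z"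
proof -
  have "qpar (z + of_int n) = qpar z * exp (2 * of_int n * of_real pi * \<i>)"
    unfolding qpar_def exp_add[symmetric] by (simp add: algebra_simps)
  also have "exp (2 * of_int n * of_real pi * \<i>) = 1" using exp_integer_2pi[of "of_int n"] by (simp add: algebra_simps)
  finally show ?thesis by simp
qed

lemma E2_plus_int: "E2 (z + of_int n) = E2 z"
  by (simp add: E2_def qpar_plus_int)

text \<open>Euclid's algorithm on the left column: with \<open>a = s * c + r\<close>, the map is the
  one with rows \<open>(c, d)\<close> and \<open>(-r, -e)\<close>, followed by the inversion and the
  translation by \<open>s\<close>. The new lower left entry is smaller than \<open>c\<close> in
  absolute value, and \<open>c = 0\<close> leaves only translations.\<close>

lemma E2_mob:
  assumes "a * d - b * c = (1::int)" "z \<in> uhp"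
  shows "E2 (mob a b c d z) = (of_int c * z + of_int d)\<^sup>2 * E2 z
     - 6 * \<i> / of_real pi * of_int c * (of_int c * z + of_int d)"
  using assms(1)
proof (induction "nat \<bar>c\<bar>" arbitrary: a b c d rule: less_induct)
  case less
  show ?case
  proof (cases "c = 0")
    case True
    with less.prems have "a = 1 \<and> d = 1 \<or> a = -1 \<and> d = -1" by (simp add: zmult_eq_1_iff)
    then show ?thesis
      using True E2_plus_int[of z b] E2_plus_int[of z "- b"] by (auto simp: mob_def)
  next
    case False
    define r where "r = a mod c"
    define s where "s = a div c"
    define e where "e = b - s * d"
    have a: "a = s * c + r" by (simp add: r_def s_def)
    have "nat \<bar>- r\<bar> < nat \<bar>c\<bar>" using False by (simp add: r_def abs_mod_less)
    moreover have det: "c * (- e) - d * (- r) = 1"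
      using less.prems by (simp add: a e_def algebra_simps)
    ultimately have IH: "E2 (mob c d (- r) (- e) z) = (of_int (- r) * z + of_int (- e))\<^sup>2 * E2 z
       - 6 * \<i> / of_real pi * of_int (- r) * (of_int (- r) * z + of_int (- e))"
      by (rule less.hyps)
    define J where "J = of_int c * z + of_int d"
    define J' where "J' = of_int (- r) * z + of_int (- e)"
    have J: "J \<noteq> 0" "J' \<noteq> 0"
      unfolding J_def J'_def using mob_denom_nonzero[OF less.prems assms(2)] mob_denom_nonzero[OF det assms(2)] by auto
    have w: "mob c d (- r) (- e) z = J / J'" by (simp add: mob_def J_def J'_def)
    have "of_int a * z + of_int b = of_int s * J - J'"
      by (simp add: a J_def J'_def e_def algebra_simps)
    then have "mob a b c d z = - 1 / (J / J') + of_int s"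
      using J unfolding mob_def J_def[symmetric] by (simp add: diff_divide_distrib)
    then have "E2 (mob a b c d z) = E2 (- 1 / (J / J'))" by (simp only: E2_plus_int)
    also have "\<dots> = (J / J')\<^sup>2 * E2 (J / J') - 6 * \<i> / of_real pi * (J / J')"
      using E2_inversion[OF mob_in_uhp[OF det assms(2)]] unfolding w .
    also have "E2 (J / J') = J'\<^sup>2 * E2 z - 6 * \<i> / of_real pi * of_int (- r) * J'"
      using IH unfolding w J'_def[symmetric] .
    also have "(J / J')\<^sup>2 * (J'\<^sup>2 * E2 z - 6 * \<i> / of_real pi * of_int (- r) * J') - 6 * \<i> / of_real pi * (J / J')
      = J\<^sup>2 * E2 z + 6 * \<i> / of_real pi * J * ((of_int r * J - 1) / J')"
      using J by (simp add: power2_eq_square field_simps)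
    also have "of_int r * J - 1 = - of_int c * J'"
    proof -
      have "of_int (c * (- e) - d * (- r)) = (1 :: complex)" using det by simp
      then show ?thesis by (simp add: J_def J'_def algebra_simps)
    qed
    finally show ?thesis using J by (simp add: J_def)
  qed
qed

section \<open>Expansions in \<open>q\<close> as functions on the unit disc\<close>

definition qexp :: "(complex \<Rightarrow> complex) \<Rightarrow> (complex \<Rightarrow> complex) \<Rightarrow> bool" where
  "qexp f F \<longleftrightarrow> F holomorphic_on ball 0 1 \<and> (\<forall>z\<in>uhp. f z = F (qpar z))"

lemma qpar_in_ball: "z \<in> uhp \<Longrightarrow> qpar z \<in> ball 0 1"
  by (simp add: norm_qpar_less_1)

lemma has_field_derivative_qpar:
  "(qpar has_field_derivative 2 * of_real pi * \<i> * qpar z) (at z within A)"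
  unfolding qpar_def [abs_def] by (auto intro!: derivative_eq_intros)

lemma qexp_has_field_derivative:
  assumes "qexp f F" "z \<in> uhp"
  shows "(f has_field_derivative 2 * of_real pi * \<i> * (qpar z * deriv F (qpar z))) (at z)"
proof -
  have "(F has_field_derivative deriv F (qpar z)) (at (qpar z))"
    using assms by (intro holomorphic_derivI[of _ "ball 0 1"]) (auto simp: qexp_def norm_qpar_less_1)
  from DERIV_chain2[OF this has_field_derivative_qpar]
  have "((\<lambda>z. F (qpar z)) has_field_derivative deriv F (qpar z) * (2 * of_real pi * \<i> * qpar z)) (at z)" .
  then have "(f has_field_derivative deriv F (qpar z) * (2 * of_real pi * \<i> * qpar z)) (at z)"
    by (rule has_field_derivative_transform_within_open[where S = uhp]) (use assms in \<open>auto simp: qexp_def\<close>)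
  then show ?thesis by (simp add: mult_ac)
qed

lemma qexp_holomorphic: "qexp f F \<Longrightarrow> f holomorphic_on uhp"
  using qexp_has_field_derivative by (subst holomorphic_on_open) auto

lemma qexp_qderiv: "qexp f F \<Longrightarrow> qexp (qderiv f) (\<lambda>w. w * deriv F w)"
  using DERIV_imp_deriv[OF qexp_has_field_derivative[of f F]]
  by (auto simp: qexp_def qderiv_def intro!: holomorphic_intros)

lemma qexp_const: "qexp (\<lambda>_. c) (\<lambda>_. c)"
  by (simp add: qexp_def)

lemma qexp_add: "qexp f F \<Longrightarrow> qexp g G \<Longrightarrow> qexp (\<lambda>z. f z + g z) (\<lambda>w. F w + G w)"
  by (auto simp: qexp_def intro!: holomorphic_intros)

lemma qexp_diff: "qexp f F \<Longrightarrow> qexp g G \<Longrightarrow> qexp (\<lambda>z. f z - g z) (\<lambda>w. F w - G w)"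
  by (auto simp: qexp_def intro!: holomorphic_intros)

lemma qexp_mult: "qexp f F \<Longrightarrow> qexp g G \<Longrightarrow> qexp (\<lambda>z. f z * g z) (\<lambda>w. F w * G w)"
  by (auto simp: qexp_def intro!: holomorphic_intros)

lemma norm_qpar_le: "Im z \<ge> 1 \<Longrightarrow> norm (qpar z) \<le> exp (- 2 * pi)"
  by (simp add: norm_qpar)

text \<open>The radius \<open>exp (- 2 * pi)\<close> is the value of \<open>norm (qpar z)\<close> at
  \<open>Im z = 1\<close>, in accordance with the growth condition in
  \<open>modular_forms\<close>.\<close>

lemma holomorphic_bounded_small_disc:
  assumes "F holomorphic_on ball 0 1"
  obtains B where "B > 0" "\<And>w. norm w \<le> exp (- 2 * pi) \<Longrightarrow> norm (F w) \<le> B"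
proof -
  have "exp (- 2 * pi) < 1" by simp
  then have "cball 0 (exp (- 2 * pi)) \<subseteq> ball (0::complex) 1"
    unfolding cball_subset_ball_iff by simp
  then have "compact (F ` cball 0 (exp (- 2 * pi)))"
    using assms by (intro compact_continuous_image holomorphic_on_imp_continuous_on) (auto intro: holomorphic_on_subset)
  then obtain B where "B > 0" "\<forall>x\<in>F ` cball 0 (exp (- 2 * pi)). norm x \<le> B"
    using compact_imp_bounded bounded_pos by metis
  then show ?thesis by (intro that) auto
qed

lemma qexp_bounded:
  assumes "qexp f F"
  shows "\<exists>B. \<forall>z. 1 \<le> Im z \<longrightarrow> norm (f z) \<le> B"
proof -
  obtain B where B: "\<And>w. norm w \<le> exp (- 2 * pi) \<Longrightarrow> norm (F w) \<le> B"
    using holomorphic_bounded_small_disc assms unfolding qexp_def by metis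
  have "norm (f z) \<le> B" if "1 \<le> Im z" for z
    using that B[OF norm_qpar_le[OF that]] assms by (simp add: qexp_def uhp_def)
  then show ?thesis by blast
qed

text \<open>Periodicity makes \<open>f (log w / (2 pi i))\<close> independent of the branch of the
  logarithm, and boundedness makes the singularity at 0 removable. The value of \<open>F\<close> at
  0 is the value of \<open>f\<close> at the cusp.\<close>

lemma periodic_imp_qexp:
  assumes hol: "f holomorphic_on uhp"
    and per: "\<And>z n. z \<in> uhp \<Longrightarrow> f (z + of_int n) = f z"
    and bdd: "\<And>z. Im z \<ge> 1 \<Longrightarrow> norm (f z) \<le> B"
  obtains F where "qexp f F"
proof -
  define F0 where "F0 = (\<lambda>w. f (Ln w / (2 * of_real pi * \<i>)))"
  have F0: "F0 (qpar z) = f z" if "z \<in> uhp" for z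
  proof -
    have "exp (Ln (qpar z)) = exp (2 * of_real pi * \<i> * z)" by (simp add: qpar_def)
    then obtain n :: int where "Ln (qpar z) = 2 * of_real pi * \<i> * z + of_int (2 * n) * of_real pi * \<i>"
      unfolding exp_eq by auto
    then have "Ln (qpar z) / (2 * of_real pi * \<i>) = z + of_int n" by (simp add: field_simps)
    then show ?thesis using per[OF that] by (simp add: F0_def)
  qed
  have loc: "F0 field_differentiable at w0" if w0: "w0 \<in> ball 0 1 - {0}" for w0
  proof -
    \<comment> \<open>\<open>Ln\<close> jumps along the negative axis, so differentiability at
      \<open>w0\<close> is shown with a branch \<open>L\<close> of the logarithm adapted to
      \<open>w0\<close>.\<close>
    define U where "U = ball w0 (norm w0) \<inter> ball 0 1"
    define L where "L = (\<lambda>w. (Ln (w / w0) + Ln w0) / (2 * of_real pi * \<i>))"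
    have U0: "w \<noteq> 0" "w / w0 \<notin> \<real>\<^sub>\<le>\<^sub>0" if "w \<in> U" for w
    proof -
      have d: "norm (w - w0) < norm w0" using that by (simp add: U_def dist_norm norm_minus_commute)
      then show "w \<noteq> 0" by auto
      have "norm (w / w0 - 1) < 1" using d w0 by (simp add: norm_divide diff_divide_distrib[symmetric] divide_simps)
      then have "Re (w / w0) > 0" using abs_Re_le_cmod[of "w / w0 - 1"] by auto
      then show "w / w0 \<notin> \<real>\<^sub>\<le>\<^sub>0" by (auto simp: complex_nonpos_Reals_iff)
    qed
    have q: "qpar (L w) = w" if "w \<in> U" for w
      using U0[OF that] w0 by (simp add: L_def qpar_def exp_add)
    have Luhp: "L w \<in> uhp" if "w \<in> U" for w
    proof -
      have "exp (- 2 * pi * Im (L w)) < 1" using that q norm_qpar[of "L w"] by (auto simp: U_def)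
      then show ?thesis by (simp add: uhp_def mult_pos_pos zero_less_mult_iff)
    qed
    have "L holomorphic_on U" unfolding L_def using U0 w0 by (auto intro!: holomorphic_intros)
    then have "(f \<circ> L) holomorphic_on U"
      using Luhp by (intro holomorphic_on_compose_gen[OF _ hol]) auto
    moreover have "(f \<circ> L) w = F0 w" if "w \<in> U" for w
      using F0[OF Luhp[OF that]] q[OF that] by simp
    ultimately have "F0 holomorphic_on U" by (rule holomorphic_transform) 
    moreover have "open U" "w0 \<in> U" using w0 by (auto simp: U_def)
    ultimately show ?thesis by (rule holomorphic_on_imp_differentiable_at)
  qed
  have "F0 holomorphic_on ball 0 1 - {0}"
    using loc by (auto simp: holomorphic_on_def intro: field_differentiable_at_within)
  moreover have "\<exists>B. eventually (\<lambda>w. norm (F0 w) \<le> B) (at 0)"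
  proof (intro exI)
    have "norm (F0 w) \<le> B" if "w \<noteq> 0" "norm w < exp (- 2 * pi)" for w
    proof -
      have "Im (Ln w / (2 * of_real pi * \<i>)) = - ln (norm w) / (2 * pi)"
        using that by (simp add: Im_divide power2_eq_square)
      moreover have "ln (norm w) \<le> - 2 * pi" using that ln_less_cancel_iff[of "norm w" "exp (- 2 * pi)"] by simp
      ultimately have "Im (Ln w / (2 * of_real pi * \<i>)) \<ge> 2 * pi / (2 * pi)"
        by (simp only:) (intro divide_right_mono, auto)
      then have "Im (Ln w / (2 * of_real pi * \<i>)) \<ge> 1" by simp
      then show ?thesis unfolding F0_def by (rule bdd)
    qed
    then show "eventually (\<lambda>w. norm (F0 w) \<le> B) (at 0)"
      unfolding eventually_at by (intro exI[of _ "exp (- 2 * pi)"]) auto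
  qed
  ultimately obtain F where "F holomorphic_on ball 0 1" "\<forall>w\<in>ball 0 1 - {0}. F w = F0 w"
    using holomorphic_on_extend_bounded[of F0 "ball 0 1" 0] by auto
  then have "qexp f F" using F0 by (auto simp: qexp_def norm_qpar_less_1)
  then show ?thesis by (rule that)
qed

definition E2q :: "complex \<Rightarrow> complex" where
  "E2q w = 1 - 24 * (w * (\<Sum>n. of_nat (divsum 1 (Suc n)) * w ^ n))"

lemma E2_series_holomorphic: "(\<lambda>w. \<Sum>n. of_nat (divsum 1 (Suc n)) * w ^ n) holomorphic_on ball 0 1"
  by (rule power_series_holomorphic[where a = "\<lambda>n. of_nat (divsum 1 (Suc n))"])
     (use summable_divsum in \<open>auto intro!: summable_sums\<close>)

lemma qexp_E2: "qexp E2 E2q"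
proof -
  have "E2 z = E2q (qpar z)" if "z \<in> uhp" for z
    using suminf_mult[OF summable_divsum[OF norm_qpar_less_1[OF that]], of "qpar z"]
    by (simp add: E2_def E2q_def mult_ac)
  then show ?thesis
    using E2_series_holomorphic unfolding qexp_def E2q_def [abs_def] by (auto intro!: holomorphic_intros)
qed

lemma E2q_0: "E2q 0 = 1" and deriv_E2q_0: "deriv E2q 0 = - 24"
proof -
  show "E2q 0 = 1" by (simp add: E2q_def)
  define S where "S = (\<lambda>w::complex. \<Sum>n. of_nat (divsum 1 (Suc n)) * w ^ n)"
  have S0: "S 0 = 1"
  proof -
    have "{d. d dvd Suc 0} = {1}" by auto
    then show ?thesis by (simp add: S_def powser_zero divsum_def)
  qed
  have "(S has_field_derivative deriv S 0) (at 0)"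
    using E2_series_holomorphic unfolding S_def by (rule holomorphic_derivI) auto
  then have "((\<lambda>w. 1 - 24 * (w * S w)) has_field_derivative - 24 * S 0) (at 0)"
    by (auto intro!: derivative_eq_intros)
  then have "deriv (\<lambda>w. 1 - 24 * (w * S w)) 0 = - 24" unfolding S0 by (simp add: DERIV_imp_deriv)
  moreover have "(\<lambda>w. 1 - 24 * (w * S w)) = E2q" by (simp add: fun_eq_iff E2q_def S_def)
  ultimately show "deriv E2q 0 = - 24" by simp
qed

lemma qexp_Dop: "qexp f F \<Longrightarrow> qexp (Dop k f) (\<lambda>w. w * deriv F w - of_real (k / 12) * E2q w * F w)"
  unfolding Dop_def by (intro qexp_diff qexp_mult qexp_qderiv qexp_E2 qexp_const)

section \<open>Modular forms, \<open>E\<^sub>4\<close> and \<open>E\<^sub>6\<close>\<close>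

lemma modular_forms_mob:
  assumes "f \<in> modular_forms w" "a * d - b * c = 1" "z \<in> uhp"
  shows "f (mob a b c d z) = (of_int c * z + of_int d) ^ w * f z"
  using assms by (simp add: modular_forms_def mob_def)

lemma modular_forms_plus_int:
  assumes "f \<in> modular_forms w" "z \<in> uhp"
  shows "f (z + of_int n) = f z"
  using modular_forms_mob[OF assms(1), of 1 1 n 0 z] assms(2) by (simp add: mob_def)

lemma modular_forms_qexp:
  assumes "f \<in> modular_forms w"
  obtains F where "qexp f F"
proof -
  obtain B where "\<forall>z. 1 \<le> Im z \<longrightarrow> norm (f z) \<le> B" "f holomorphic_on uhp"
    using assms by (auto simp: modular_forms_def)
  then show ?thesis
    using periodic_imp_qexp[of f B] modular_forms_plus_int[OF assms] that by blast
qed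

lemma modular_formsI:
  assumes "qexp f F"
    and "\<And>a b c d z. a * d - b * c = 1 \<Longrightarrow> z \<in> uhp \<Longrightarrow> f (mob a b c d z) = (of_int c * z + of_int d) ^ w * f z"
  shows "f \<in> modular_forms w"
  unfolding modular_forms_def using qexp_holomorphic[OF assms(1)] qexp_bounded[OF assms(1)] assms(2)
  by (simp add: mob_def)

lemma modular_forms_holomorphic: "f \<in> modular_forms w \<Longrightarrow> f holomorphic_on uhp"
  by (simp add: modular_forms_def)

lemma modular_forms_add:
  assumes "f \<in> modular_forms w" "g \<in> modular_forms w"
  shows "(\<lambda>z. f z + g z) \<in> modular_forms w"
proof -
  obtain F G where "qexp f F" "qexp g G" using assms modular_forms_qexp by metis
  from modular_formsI[OF qexp_add[OF this]] show ?thesis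
    by (simp add: modular_forms_mob[OF assms(1)] modular_forms_mob[OF assms(2)] algebra_simps)
qed

lemma modular_forms_mult:
  assumes "f \<in> modular_forms w" "g \<in> modular_forms v"
  shows "(\<lambda>z. f z * g z) \<in> modular_forms (w + v)"
proof -
  obtain F G where "qexp f F" "qexp g G" using assms modular_forms_qexp by metis
  from modular_formsI[OF qexp_mult[OF this]] show ?thesis
    by (simp add: modular_forms_mob[OF assms(1)] modular_forms_mob[OF assms(2)] power_add algebra_simps)
qed

lemma modular_forms_const: "(\<lambda>_. c) \<in> modular_forms 0"
  using modular_formsI[OF qexp_const] by simp

lemma modular_forms_cmult: "f \<in> modular_forms w \<Longrightarrow> (\<lambda>z. c * f z) \<in> modular_forms w"
  using modular_forms_mult[OF modular_forms_const] by simp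

lemma modular_forms_power: "f \<in> modular_forms w \<Longrightarrow> (\<lambda>z. f z ^ n) \<in> modular_forms (w * n)"
proof (induction n)
  case 0
  show ?case using modular_forms_const[of 1] by simp
next
  case (Suc n)
  from modular_forms_mult[OF Suc.prems Suc.IH[OF Suc.prems]] show ?case by simp
qed

lemma modular_forms_zero: "(\<lambda>_. 0) \<in> modular_forms w"
  using modular_formsI[OF qexp_const[of 0]] by simp

lemma modular_forms_cong:
  assumes "f \<in> modular_forms w" "\<And>z. z \<in> uhp \<Longrightarrow> g z = f z"
  shows "g \<in> modular_forms w"
proof -
  obtain F where F: "qexp f F" using assms modular_forms_qexp by metis
  then have "qexp g F" using assms(2) by (simp add: qexp_def)
  then show ?thesis
    by (rule modular_formsI) (simp add: assms(2) mob_in_uhp modular_forms_mob[OF assms(1)])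
qed

lemma deriv_mob:
  assumes "f holomorphic_on uhp" "a * d - b * c = 1" "z \<in> uhp"
  shows "((\<lambda>z. f (mob a b c d z)) has_field_derivative
    deriv f (mob a b c d z) / (of_int c * z + of_int d)\<^sup>2) (at z)"
proof -
  have "(f has_field_derivative deriv f (mob a b c d z)) (at (mob a b c d z))"
    using assms mob_in_uhp by (intro holomorphic_derivI[of _ uhp]) auto
  from DERIV_chain2[OF this has_field_derivative_mob[OF assms(2,3)]] show ?thesis by simp
qed

lemma deriv_mob_eq:
  assumes f: "f holomorphic_on uhp" and det: "a * d - b * c = 1" and z: "z \<in> uhp"
    and tr: "\<And>z. z \<in> uhp \<Longrightarrow> f (mob a b c d z) = h z"
    and h: "(h has_field_derivative h') (at z)"
  shows "deriv f (mob a b c d z) = (of_int c * z + of_int d)\<^sup>2 * h'"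
proof -
  have "(h has_field_derivative deriv f (mob a b c d z) / (of_int c * z + of_int d)\<^sup>2) (at z)"
    by (rule has_field_derivative_transform_within_open[OF deriv_mob[OF f det z] open_uhp z]) (rule tr)
  then have "deriv f (mob a b c d z) / (of_int c * z + of_int d)\<^sup>2 = h'"
    using h DERIV_unique by blast
  then show ?thesis using mob_denom_nonzero[OF det z] by (simp add: field_simps)
qed

text \<open>Differentiating the factor \<open>J^w\<close> adds a multiple of
  \<open>w * c * J^(w + 1) * f\<close>; the non-modular term of \<open>E2\<close>, weighted by
  \<open>w / 12\<close>, removes it. The link between the constants is
  \<open>6 i / pi = -12 / (2 pi i)\<close>.\<close>

lemma modular_forms_Dop:
  assumes f: "f \<in> modular_forms w"
  shows "Dop (real w) f \<in> modular_forms (w + 2)"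
proof -
  obtain F where F: "qexp f F" using modular_forms_qexp[OF f] .
  note holo = modular_forms_holomorphic[OF f]
  show ?thesis
  proof (rule modular_formsI[OF qexp_Dop[OF F]])
    fix a b c d :: int and z assume det: "a * d - b * c = 1" and z: "z \<in> uhp"
    define J where "J = of_int c * z + of_int d"
    have J: "J \<noteq> 0" unfolding J_def by (rule mob_denom_nonzero[OF det z])
    have df: "(f has_field_derivative deriv f z) (at z)"
      by (rule holomorphic_derivI[OF holo open_uhp z])
    have "((\<lambda>z. (of_int c * z + of_int d) ^ w * f z) has_field_derivative
        (of_nat w * J ^ (w - 1) * of_int c) * f z + J ^ w * deriv f z) (at z)"
      by (auto intro!: derivative_eq_intros df simp: J_def)
    from deriv_mob_eq[OF holo det z modular_forms_mob[OF f det] this]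
    have "deriv f (mob a b c d z) = J\<^sup>2 * ((of_nat w * J ^ (w - 1) * of_int c) * f z + J ^ w * deriv f z)"
      by (simp add: J_def)
    also have "\<dots> = J * (of_nat w * (J * J ^ (w - 1)) * of_int c) * f z + J ^ (w + 2) * deriv f z"
      by (simp add: algebra_simps power2_eq_square)
    \<comment> \<open>For \<open>w = 0\<close> the truncated exponent \<open>w - 1\<close> is wrong,
      but the factor \<open>w\<close> vanishes.\<close>
    also have "of_nat w * (J * J ^ (w - 1)) = of_nat w * J ^ w"
      by (cases w) simp_all
    finally have D: "deriv f (mob a b c d z) = of_nat w * of_int c * J ^ (w + 1) * f z + J ^ (w + 2) * deriv f z"
      by (simp add: algebra_simps)
    show "Dop (real w) f (mob a b c d z) = (of_int c * z + of_int d) ^ (w + 2) * Dop (real w) f z"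
    proof -
      define T where "T = 1 / (2 * of_real pi * \<i>)"
      have k: "6 * \<i> / of_real pi = - 12 * T" by (simp add: T_def divide_simps)
      have q: "qderiv f x = T * deriv f x" for x by (simp add: qderiv_def T_def)
      have "T * (of_nat w * C * J ^ (w + 1) * u + J ^ (w + 2) * u')
          - of_real (real w / 12) * (J\<^sup>2 * e - - 12 * T * C * J) * (J ^ w * u)
        = J ^ (w + 2) * (T * u' - of_real (real w / 12) * e * u)" for C e u u' :: complex
        by (simp add: algebra_simps power2_eq_square)
      then show ?thesis
        unfolding Dop_def q D E2_mob[OF det z] modular_forms_mob[OF f det z] J_def[symmetric] k .
    qed
  qed
qed

section \<open>The Eisenstein series of weights 4 and 6\<close>

definition E4 :: "complex \<Rightarrow> complex" where "E4 z = E2 z * E2 z - 12 * qderiv E2 z"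
definition E6 :: "complex \<Rightarrow> complex" where "E6 z = E2 z * E4 z - 3 * qderiv E4 z"
definition E4q :: "complex \<Rightarrow> complex" where "E4q w = E2q w * E2q w - 12 * (w * deriv E2q w)"
definition E6q :: "complex \<Rightarrow> complex" where "E6q w = E2q w * E4q w - 3 * (w * deriv E4q w)"

lemma qexp_E4: "qexp E4 E4q"
  unfolding E4_def [abs_def] E4q_def [abs_def]
  by (intro qexp_diff qexp_mult qexp_qderiv qexp_E2 qexp_const)

lemma qexp_E6: "qexp E6 E6q"
  unfolding E6_def [abs_def] E6q_def [abs_def]
  by (intro qexp_diff qexp_mult qexp_qderiv qexp_E4 qexp_E2 qexp_const)

text \<open>Squaring \<open>E2\<close> and differentiating it both create terms in
  \<open>c * J^3 * E2\<close> and \<open>c^2 * J^2\<close>; the factor 12 is the one for which both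
  kinds cancel.\<close>

lemma E4_modular: "E4 \<in> modular_forms 4"
proof (rule modular_formsI[OF qexp_E4])
  fix a b c d :: int and z assume det: "a * d - b * c = 1" and z: "z \<in> uhp"
  define J where "J = of_int c * z + of_int d"
  have holo: "E2 holomorphic_on uhp" by (rule qexp_holomorphic[OF qexp_E2])
  have df: "(E2 has_field_derivative deriv E2 z) (at z)"
    by (rule holomorphic_derivI[OF holo open_uhp z])
  have "((\<lambda>z. (of_int c * z + of_int d)\<^sup>2 * E2 z - 6 * \<i> / of_real pi * of_int c * (of_int c * z + of_int d)) has_field_derivative
      2 * J * of_int c * E2 z + J\<^sup>2 * deriv E2 z - 6 * \<i> / of_real pi * of_int c * of_int c) (at z)"
  proof -
    have "((\<lambda>z. of_int c * z + of_int d) has_field_derivative of_int c) (at z)"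
      by (auto intro!: derivative_eq_intros)
    from DERIV_diff[OF DERIV_mult[OF DERIV_power[OF this, of 2] df] DERIV_cmult[OF this, of "6 * \<i> / of_real pi * of_int c"]]
    show ?thesis by (rule DERIV_cong) (simp add: J_def mult_ac add_ac)
  qed
  from deriv_mob_eq[OF holo det z E2_mob[OF det] this]
  have D: "deriv E2 (mob a b c d z) = J\<^sup>2 * (2 * J * of_int c * E2 z + J\<^sup>2 * deriv E2 z - 6 * \<i> / of_real pi * of_int c * of_int c)"
    by (simp add: J_def)
  show "E4 (mob a b c d z) = (of_int c * z + of_int d) ^ 4 * E4 z"
  proof -
    define T where "T = 1 / (2 * of_real pi * \<i>)"
    have k: "6 * \<i> / of_real pi = - 12 * T" by (simp add: T_def divide_simps)
    have q: "qderiv E2 x = T * deriv E2 x" for x by (simp add: qderiv_def T_def)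
    have "(J\<^sup>2 * e - - 12 * T * C * J) * (J\<^sup>2 * e - - 12 * T * C * J)
        - 12 * (T * (J\<^sup>2 * (2 * J * C * e + J\<^sup>2 * e' - - 12 * T * C * C))) = J ^ 4 * (e * e - 12 * (T * e'))"
      for C e e' :: complex
      by (simp add: algebra_simps power2_eq_square power4_eq_xxxx)
    then show ?thesis unfolding E4_def q D E2_mob[OF det z] J_def[symmetric] k .
  qed
qed

lemma E6_eq_Dop: "E6 = (\<lambda>z. - 3 * Dop (real 4) E4 z)"
  by (simp add: fun_eq_iff E6_def Dop_def)

lemma E6_modular: "E6 \<in> modular_forms 6"
  using modular_forms_cmult[OF modular_forms_Dop[OF E4_modular], of "-3"] unfolding E6_eq_Dop by simp

lemma E4q_0: "E4q 0 = 1" and E6q_0: "E6q 0 = 1"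
  by (simp_all add: E4q_def E6q_def E2q_0)

text \<open>The linear coefficients show later that \<open>Delta\<close> does not vanish
  identically.\<close>

lemma deriv_E4q_0: "deriv E4q 0 = 240" and deriv_E6q_0: "deriv E6q 0 = - 504"
proof -
  have h: "E2q holomorphic_on ball 0 1" "E4q holomorphic_on ball 0 1"
    using qexp_E2 qexp_E4 by (simp_all add: qexp_def)
  have d2: "(E2q has_field_derivative - 24) (at 0)"
    using holomorphic_derivI[OF h(1), of 0] by (simp add: deriv_E2q_0)
  have d2': "(deriv E2q has_field_derivative deriv (deriv E2q) 0) (at 0)"
    using h by (intro holomorphic_derivI[of _ "ball 0 1"] holomorphic_intros) auto
  have "((\<lambda>w. E2q w * E2q w - 12 * (w * deriv E2q w)) has_field_derivative 240) (at 0)"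
    by (auto intro!: derivative_eq_intros d2 d2' simp: E2q_0 deriv_E2q_0)
  then show d4: "deriv E4q 0 = 240" unfolding E4q_def [abs_def] by (rule DERIV_imp_deriv)
  then have d4': "(E4q has_field_derivative 240) (at 0)"
    using holomorphic_derivI[OF h(2), of 0] by simp
  have d4'': "(deriv E4q has_field_derivative deriv (deriv E4q) 0) (at 0)"
    using h by (intro holomorphic_derivI[of _ "ball 0 1"] holomorphic_intros) auto
  have "((\<lambda>w. E2q w * E4q w - 3 * (w * deriv E4q w)) has_field_derivative - 504) (at 0)"
    by (auto intro!: derivative_eq_intros d2 d4' d4'' simp: E2q_0 E4q_0 d4)
  then show "deriv E6q 0 = - 504" unfolding E6q_def [abs_def] by (rule DERIV_imp_deriv)
qed

section \<open>Absence of cusp forms of small weight\<close>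

text \<open>Reduction to the fundamental domain. A shortest lattice vector \<open>c z + d\<close> is
  primitive and completes to a matrix, a translation brings the real part into range, and minimality
  forces the image to have norm at least 1. The constant \<open>43 / 50\<close> is a rational bound
  just below \<open>sqrt 3 / 2\<close>.\<close>

lemma uhp_orbit_high_point:
  assumes "z \<in> uhp"
  obtains a b c d :: int where "a * d - b * c = 1" "\<bar>Re (mob a b c d z)\<bar> \<le> 1 / 2" "Im (mob a b c d z) \<ge> 43 / 50"
proof -
  obtain \<delta> where \<delta>: "\<delta> > 0" "\<And>a b :: real. \<delta> * (a\<^sup>2 + b\<^sup>2) \<le> (norm (of_real a * z + of_real b))\<^sup>2"
    using lattice_lower_bound[OF assms] by metis
  define N where "N = (\<lambda>(c, d). norm (of_int c * z + of_int d))"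
  define R where "R = \<lceil>1 / \<delta>\<rceil>"
  \<comment> \<open>The vector \<open>(0, 1)\<close> has norm 1, so a shortest vector is found among
    those of norm at most 1, and these are finitely many.\<close>
  define P where "P = {(c, d). (c, d) \<noteq> (0, 0) \<and> N (c, d) \<le> 1}"
  have "P \<subseteq> {-R..R} \<times> {-R..R}"
  proof safe
    fix c d :: int assume "(c, d) \<in> P"
    then have n: "norm (of_int c * z + of_int d) \<le> 1" by (simp add: P_def N_def)
    have "\<delta> * ((of_int c)\<^sup>2 + (of_int d)\<^sup>2) \<le> (norm (of_int c * z + of_int d))\<^sup>2"
      using \<delta>(2)[of "of_int c" "of_int d"] by simp
    also have "\<dots> \<le> 1" using n by (simp add: power_le_one)
    finally have s: "(of_int c)\<^sup>2 + (of_int d)\<^sup>2 \<le> 1 / \<delta>" using \<delta>(1) by (simp add: field_simps)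
    have b: "\<bar>x\<bar> \<le> x\<^sup>2" for x :: int
    proof (cases "x = 0")
      case False
      then have "\<bar>x\<bar> * 1 \<le> \<bar>x\<bar> * \<bar>x\<bar>" by (intro mult_left_mono) auto
      then show ?thesis by (simp add: power2_eq_square)
    qed simp
    have "real_of_int (c\<^sup>2 + d\<^sup>2) \<le> 1 / \<delta>" using s by simp
    then have cd: "c\<^sup>2 + d\<^sup>2 \<le> R" unfolding R_def by linarith
    have "\<bar>c\<bar> \<le> R" "\<bar>d\<bar> \<le> R" using b[of c] b[of d] cd zero_le_power2[of c] zero_le_power2[of d] by linarith+
    then show "c \<in> {-R..R}" "d \<in> {-R..R}" by auto
  qed
  then have fin: "finite P" by (rule finite_subset) auto
  have "(0, 1) \<in> P" by (simp add: P_def N_def)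
  then obtain cd where cd: "cd \<in> P" "\<And>x. x \<in> P \<Longrightarrow> N cd \<le> N x"
    using arg_min_if_finite(1)[OF fin, of N] arg_min_least[OF fin, of _ N] by blast
  obtain c0 d0 where cd0: "cd = (c0, d0)" by fastforce
  have minimal: "N (c0, d0) \<le> N (c, d)" if "(c, d) \<noteq> (0, 0)" for c d
  proof (cases "N (c, d) \<le> 1")
    case True
    then show ?thesis using that cd by (auto simp: P_def cd0)
  next
    case False
    then show ?thesis using cd(1) by (simp add: P_def cd0)
  qed
  have nz: "(c0, d0) \<noteq> (0, 0)" using cd(1) by (simp add: P_def cd0)
  \<comment> \<open>Division by a common factor would give a shorter nonzero vector.\<close>
  have "gcd c0 d0 = 1"
  proof -
    define g where "g = gcd c0 d0"
    have g: "g > 0" using nz by (auto simp: g_def)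
    have e: "c0 = g * (c0 div g)" "d0 = g * (d0 div g)" by (simp_all add: g_def)
    have "of_int c0 * z + of_int d0 = of_int g * (of_int (c0 div g) * z + of_int (d0 div g))"
      unfolding distrib_left mult.assoc[symmetric] of_int_mult[symmetric] e[symmetric] ..
    then have "N (c0, d0) = real_of_int g * N (c0 div g, d0 div g)"
      using g by (simp add: N_def norm_mult)
    moreover have "(c0 div g, d0 div g) \<noteq> (0, 0)"
      using nz by (metis e Pair_inject mult_zero_right)
    note minimal[OF this]
    moreover have "N (c0, d0) > 0"
    proof -
      have "0 < \<delta> * ((of_int c0)\<^sup>2 + (of_int d0)\<^sup>2)"
        using \<delta>(1) nz by (auto simp: sum_power2_gt_zero_iff)
      also have "\<dots> \<le> (N (c0, d0))\<^sup>2" using \<delta>(2)[of "of_int c0" "of_int d0"] by (simp add: N_def)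
      finally show ?thesis by (auto simp: N_def)
    qed
    ultimately have "real_of_int g * N (c0 div g, d0 div g) \<le> 1 * N (c0 div g, d0 div g)" "N (c0 div g, d0 div g) > 0"
      using g by (simp_all add: zero_less_mult_iff)
    then have "real_of_int g \<le> 1" by (simp only: mult_le_cancel_right_pos)
    then have "g = 1" using g by linarith
    then show ?thesis by (simp add: g_def)
  qed
  then obtain u v where uv: "u * c0 + v * d0 = 1" by (metis bezout_int)
  define w where "w = mob v (- u) c0 d0 z"
  define n where "n = round (Re w)"
  define a b where "a = v - n * c0" and "b = - u - n * d0"
  have det: "a * d0 - b * c0 = 1" using uv by (simp add: a_def b_def algebra_simps)
  have J: "of_int c0 * z + of_int d0 \<noteq> 0" by (rule mob_denom_nonzero[OF det assms])
  have t: "mob a b c0 d0 z = w - of_int n"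
  proof -
    have "of_int a * z + of_int b = (of_int v * z + of_int (- u)) - of_int n * (of_int c0 * z + of_int d0)"
      by (simp add: a_def b_def algebra_simps)
    then show ?thesis unfolding mob_def w_def
      by (simp only: diff_divide_distrib nonzero_mult_div_cancel_right[OF J])
  qed
  define t where "t = mob a b c0 d0 z"
  have tu: "t \<in> uhp" unfolding t_def by (rule mob_in_uhp[OF det assms])
  have re: "\<bar>Re t\<bar> \<le> 1 / 2"
    using of_int_round_abs_le[of "Re w"] by (simp add: t_def t n_def abs_minus_commute)
  \<comment> \<open>The upper row \<open>(a, b)\<close> is itself a nonzero lattice vector, hence
    not shorter than the denominator.\<close>
  have "norm t \<ge> 1"
  proof -
    have "(a, b) \<noteq> (0, 0)" using det by auto
    then have "N (c0, d0) \<le> N (a, b)" by (rule minimal)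
    moreover have "norm t = N (a, b) / N (c0, d0)" by (simp add: t_def mob_def N_def norm_divide)
    ultimately show ?thesis using J by (simp add: N_def)
  qed
  then have "1 \<le> (Re t)\<^sup>2 + (Im t)\<^sup>2" using one_le_power[of "norm t" 2] by (simp only: cmod_power2)
  moreover have "(Re t)\<^sup>2 \<le> (1 / 2)\<^sup>2" using power_mono[OF re, of 2] by simp
  moreover have "(43 / 50)\<^sup>2 \<le> 1 - (1 / 2 :: real)\<^sup>2" by (simp add: power2_eq_square)
  ultimately have "(43 / 50)\<^sup>2 \<le> (Im t)\<^sup>2" by linarith
  moreover have "0 \<le> Im t" using uhpD[OF tu] by simp
  ultimately have "43 / 50 \<le> Im t" by (rule power2_le_imp_le)
  with det re show ?thesis unfolding t_def by (rule that)
qed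

section \<open>The maximum principle for cusp forms\<close>

lemma qpar_Ln:
  assumes "w \<noteq> 0" "norm w < 1"
  shows "qpar (Ln w / (2 * of_real pi * \<i>)) = w" "Ln w / (2 * of_real pi * \<i>) \<in> uhp"
proof -
  show q: "qpar (Ln w / (2 * of_real pi * \<i>)) = w" using assms by (simp add: qpar_def)
  have "exp (- 2 * pi * Im (Ln w / (2 * of_real pi * \<i>))) < 1"
    using assms(2) norm_qpar q by metis
  then show "Ln w / (2 * of_real pi * \<i>) \<in> uhp" by (simp add: uhp_def zero_less_mult_iff)
qed

lemma holomorphic_factor_zero_at_0:
  assumes "F holomorphic_on ball 0 1" "F 0 = (0::complex)"
  obtains G where "G holomorphic_on ball 0 1" "\<And>w. w \<in> ball 0 1 \<Longrightarrow> F w = w * G w"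
proof -
  define G where "G = (\<lambda>w. if w = 0 then deriv F 0 else (F w - F 0) / (w - 0))"
  have "G holomorphic_on ball 0 1"
    unfolding G_def by (rule pole_lemma_open[OF assms(1) open_ball])
  moreover have "F w = w * G w" for w using assms(2) by (simp add: G_def)
  ultimately show ?thesis using that by blast
qed

lemma modular_form_norm_invariant:
  assumes "f \<in> modular_forms (2 * n)" "a * d - b * c = 1" "z \<in> uhp"
  shows "norm (f (mob a b c d z)) * Im (mob a b c d z) ^ n = norm (f z) * Im z ^ n"
proof -
  define J where "J = norm (of_int c * z + of_int d)"
  have "J \<noteq> 0" unfolding J_def using mob_denom_nonzero[OF assms(2,3)] by simp
  then show ?thesis
    unfolding modular_forms_mob[OF assms] Im_mob[OF assms(2,3)] norm_mult norm_power J_def[symmetric]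
    by (simp add: power_divide power_mult)
qed

text \<open>Let \<open>z\<^sub>0\<close> be a maximum of the invariant function \<open>\<bar>f\<bar> (Im z)\<^sup>n\<close>, with \<open>Im z\<^sub>0 \<ge> 43/50\<close>. The maximum principle for
  \<open>F(q) / q\<close> on the disc corresponding to \<open>Im z \<ge> 21/25\<close> then gives \<open>2 \<pi> \<le> 5 * 25 / 21 < 6\<close>.\<close>

lemma cusp_form_zero:
  assumes f: "f \<in> modular_forms (2 * n)" and n: "n \<le> 5" and F: "qexp f F" and F0: "F 0 = 0"
    and z1: "z1 \<in> uhp"
  shows "f z1 = 0"
proof (rule ccontr)
  assume nz: "f z1 \<noteq> 0"
  define \<phi> where "\<phi> = (\<lambda>z. norm (f z) * Im z ^ n)"
  obtain G where G: "G holomorphic_on ball 0 1" "\<And>w. w \<in> ball 0 1 \<Longrightarrow> F w = w * G w"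
    using holomorphic_factor_zero_at_0 F F0 unfolding qexp_def by metis
  have fG: "norm (f z) = exp (- 2 * pi * Im z) * norm (G (qpar z))" if "z \<in> uhp" for z
    using that F G(2)[OF qpar_in_ball[OF that]] by (simp add: qexp_def norm_mult norm_qpar)
  obtain B where B: "B > 0" "\<And>w. norm w \<le> exp (- 2 * pi) \<Longrightarrow> norm (G w) \<le> B"
    using holomorphic_bounded_small_disc[OF G(1)] by metis
  have pos: "\<phi> z1 > 0" using nz z1 by (simp add: \<phi>_def uhp_def)
  \<comment> \<open>A cusp form decays exponentially. Above some height \<open>\<phi>\<close> stays
    below its value at \<open>z1\<close>, so its supremum is attained on a compact box.\<close>
  have "((\<lambda>y. B * (y ^ n / exp y)) \<longlongrightarrow> B * 0) at_top"
    by (intro tendsto_mult tendsto_const tendsto_power_div_exp_0)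
  then have "eventually (\<lambda>y. B * (y ^ n / exp y) < \<phi> z1) at_top"
    using pos by (auto dest: order_tendstoD)
  then obtain Y where Y: "\<And>y. y \<ge> Y \<Longrightarrow> B * (y ^ n / exp y) < \<phi> z1"
    unfolding eventually_at_top_linorder by blast
  define Y' where "Y' = max 1 Y"
  define K where "K = {z. \<bar>Re z\<bar> \<le> 1 / 2 \<and> 43 / 50 \<le> Im z \<and> Im z \<le> Y'}"
  have high: "\<phi> z < \<phi> z1" if "Im z \<ge> Y'" for z
  proof -
    have i: "Im z \<ge> 1" "Im z \<ge> Y" using that by (auto simp: Y'_def)
    then have u: "z \<in> uhp" by (simp add: uhp_def)
    have "\<phi> z \<le> exp (- 2 * pi * Im z) * B * Im z ^ n"
      unfolding \<phi>_def fG[OF u] using i B(2)[OF norm_qpar_le[OF i(1)]]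
      by (intro mult_right_mono mult_left_mono) auto
    also have "\<dots> \<le> exp (- Im z) * B * Im z ^ n"
    proof -
      have "1 * Im z \<le> (2 * pi) * Im z" using i pi_gt3 by (intro mult_right_mono) auto
      then show ?thesis using B(1) i by (intro mult_right_mono) auto
    qed
    also have "\<dots> = B * (Im z ^ n / exp (Im z))" by (simp add: exp_minus divide_inverse)
    also have "\<dots> < \<phi> z1" by (rule Y[OF i(2)])
    finally show ?thesis .
  qed
  have orbit: "\<exists>t. \<phi> t = \<phi> z \<and> \<bar>Re t\<bar> \<le> 1 / 2 \<and> Im t \<ge> 43 / 50" if u: "z \<in> uhp" for z
  proof -
    obtain a b c d :: int where "a * d - b * c = 1" "\<bar>Re (mob a b c d z)\<bar> \<le> 1 / 2" "Im (mob a b c d z) \<ge> 43 / 50"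
      using uhp_orbit_high_point[OF u] by metis
    then show ?thesis using modular_form_norm_invariant[OF f _ u] unfolding \<phi>_def by metis
  qed
  have K_cbox: "K = cbox (Complex (- 1 / 2) (43 / 50)) (Complex (1 / 2) Y')"
    by (auto simp: K_def in_cbox_complex_iff)
  have "compact K" unfolding K_cbox by (rule compact_cbox)
  moreover have "continuous_on K \<phi>"
  proof -
    have "K \<subseteq> uhp" by (auto simp: K_def uhp_def)
    then have "continuous_on K f"
      using modular_forms_holomorphic[OF f] holomorphic_on_imp_continuous_on continuous_on_subset by blast
    then show ?thesis unfolding \<phi>_def by (intro continuous_intros)
  qed
  moreover obtain t1 where t1: "\<phi> t1 = \<phi> z1" "\<bar>Re t1\<bar> \<le> 1 / 2" "Im t1 \<ge> 43 / 50"
    using orbit[OF z1] by blast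
  then have "t1 \<in> K" using high[of t1] by (force simp: K_def)
  ultimately obtain z0 where z0: "z0 \<in> K" "\<And>z. z \<in> K \<Longrightarrow> \<phi> z \<le> \<phi> z0"
    using continuous_attains_sup[of K \<phi>] by auto
  have max: "\<phi> z \<le> \<phi> z0" if "z \<in> uhp" for z
  proof -
    obtain t where t: "\<phi> t = \<phi> z" "\<bar>Re t\<bar> \<le> 1 / 2" "Im t \<ge> 43 / 50" using orbit[OF \<open>z \<in> uhp\<close>] by blast
    show ?thesis
    proof (cases "Im t \<le> Y'")
      case True
      then show ?thesis using t z0(2)[of t] by (simp add: K_def)
    next
      case False
      then have "\<phi> t < \<phi> t1" using high[of t] t1 by simp
      then show ?thesis using z0(2)[OF \<open>t1 \<in> K\<close>] t by simp
    qed
  qed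
  define y0 where "y0 = Im z0"
  \<comment> \<open>The height must lie strictly below \<open>43 / 50\<close> and above
    \<open>5 / (2 pi)\<close>, which is less than \<open>0.8\<close>. Such a choice exists because
    \<open>n\<close> is at most 5.\<close>
  define y1 :: real where "y1 = 21 / 25"
  have y1: "y1 > 0" by (simp add: y1_def)
  have y0: "y0 \<ge> 43 / 50" using z0(1) by (simp add: y0_def K_def)
  have u0: "z0 \<in> uhp" using y0 by (simp add: uhp_def y0_def)
  define M where "M = \<phi> z0"
  have Mpos: "M > 0" using pos max[OF z1] by (simp add: M_def)
  have GB: "norm (G w) \<le> exp (2 * pi * y1) * (M / y1 ^ n)" if "norm w = exp (- 2 * pi * y1)" for w
  proof -
    have w: "w \<noteq> 0" "norm w < 1" using that y1 by auto
    define z where "z = Ln w / (2 * of_real pi * \<i>)"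
    have z: "qpar z = w" "z \<in> uhp" unfolding z_def using qpar_Ln[OF w] by auto
    have "exp (- 2 * pi * Im z) = exp (- 2 * pi * y1)" using that z norm_qpar by metis
    then have iz: "Im z = y1" by simp
    have "norm (f z) * y1 ^ n \<le> M" using max[OF z(2)] by (simp add: \<phi>_def M_def iz)
    then have "norm (f z) \<le> M / y1 ^ n" using y1 by (simp add: pos_le_divide_eq)
    moreover have "norm (G w) = exp (2 * pi * y1) * norm (f z)"
      unfolding fG[OF z(2)] iz z(1) by (simp add: exp_minus)
    ultimately show ?thesis by (metis exp_ge_zero mult_left_mono)
  qed
  have "norm (G (qpar z0)) \<le> exp (2 * pi * y1) * (M / y1 ^ n)"
  proof (rule maximum_modulus_frontier[of G "cball 0 (exp (- 2 * pi * y1))"])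
    have sub: "cball 0 (exp (- 2 * pi * y1)) \<subseteq> ball (0::complex) 1"
      unfolding cball_subset_ball_iff by (simp add: y1_def)
    then show "G holomorphic_on interior (cball 0 (exp (- 2 * pi * y1)))"
      using G(1) holomorphic_on_subset interior_subset by blast
    show "continuous_on (closure (cball 0 (exp (- 2 * pi * y1)))) G"
      using G(1) sub by (simp add: holomorphic_on_imp_continuous_on holomorphic_on_subset)
    show "qpar z0 \<in> cball 0 (exp (- 2 * pi * y1))"
      using y0 by (simp add: norm_qpar y0_def y1_def)
  qed (use GB in \<open>auto simp: frontier_cball\<close>)
  moreover have "M = exp (- 2 * pi * y0) * norm (G (qpar z0)) * y0 ^ n"
    unfolding M_def \<phi>_def by (simp add: fG[OF u0] y0_def)
  then have "norm (G (qpar z0)) = exp (2 * pi * y0) * (M / y0 ^ n)"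
    using y0 by (simp add: exp_minus)
  ultimately have "M * (exp (2 * pi * y0) / y0 ^ n) \<le> M * (exp (2 * pi * y1) / y1 ^ n)"
    by (simp add: mult.commute)
  then have "exp (2 * pi * y0) / y0 ^ n \<le> exp (2 * pi * y1) / y1 ^ n"
    using Mpos by (simp only: mult_le_cancel_left_pos)
  then have "ln (exp (2 * pi * y0) / y0 ^ n) \<le> ln (exp (2 * pi * y1) / y1 ^ n)"
    using y0 y1 by (subst ln_le_cancel_iff) auto
  then have le: "2 * pi * y0 - n * ln y0 \<le> 2 * pi * y1 - n * ln y1"
    using y0 y1 by (simp add: ln_div ln_realpow)
  \<comment> \<open>The bound \<open>ln x <= x - 1\<close> makes the inequality linear in
    \<open>y0 - y1\<close>, which is positive and cancels.\<close>
  have "ln (y0 / y1) \<le> y0 / y1 - 1" using y0 by (intro ln_le_minus_one) (auto simp: y1_def)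
  moreover have "ln (y0 / y1) = ln y0 - ln y1" using y0 y1 by (simp add: ln_div)
  moreover have "ln (y0 / y1) \<ge> 0" using y0 by (intro ln_ge_zero) (simp add: y1_def)
  ultimately have "n * (ln y0 - ln y1) \<le> 5 * (y0 / y1 - 1)"
    using n by (intro mult_mono) auto
  then have "2 * pi * (y0 - y1) \<le> (5 / y1) * (y0 - y1)"
    using le by (simp add: algebra_simps y1_def)
  moreover have "0 < y0 - y1" using y0 by (simp add: y1_def)
  ultimately have "2 * pi \<le> 5 / y1" by (simp only: mult_le_cancel_right_pos)
  then show False using pi_gt3 by (simp add: y1_def)
qed

section \<open>The discriminant\<close>

lemma qderiv_E4: "qderiv E4 z = (E2 z * E4 z - E6 z) / 3"
  by (simp add: E6_def)

text \<open>The Serre derivative of \<open>E6\<close> has constant term \<open>-1 / 2\<close>, so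
  adding half of \<open>E4^2\<close> gives a cusp form of weight 8, which vanishes.\<close>

lemma qderiv_E6:
  assumes "z \<in> uhp"
  shows "qderiv E6 z = (E2 z * E6 z - E4 z * E4 z) / 2"
proof -
  have m: "(\<lambda>z. Dop (real 6) E6 z + 1 / 2 * (E4 z * E4 z)) \<in> modular_forms (2 * 4)"
  proof (rule modular_forms_add)
    show "Dop (real 6) E6 \<in> modular_forms (2 * 4)"
      using modular_forms_Dop[OF E6_modular] by simp
    show "(\<lambda>z. 1 / 2 * (E4 z * E4 z)) \<in> modular_forms (2 * 4)"
      using modular_forms_cmult[OF modular_forms_mult[OF E4_modular E4_modular], of "1 / 2"] by simp
  qed
  have q: "qexp (\<lambda>z. Dop (real 6) E6 z + 1 / 2 * (E4 z * E4 z))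
      (\<lambda>w. (w * deriv E6q w - of_real (real 6 / 12) * E2q w * E6q w) + 1 / 2 * (E4q w * E4q w))"
    by (intro qexp_add qexp_Dop qexp_E6 qexp_mult qexp_E4 qexp_const)
  have "Dop (real 6) E6 z + 1 / 2 * (E4 z * E4 z) = 0"
    by (rule cusp_form_zero[OF m _ q _ assms]) (simp_all add: E2q_0 E4q_0 E6q_0)
  then show ?thesis by (simp add: Dop_def field_simps)
qed

text \<open>This is 1728 times the usual discriminant.\<close>

definition Delta :: "complex \<Rightarrow> complex" where "Delta z = E4 z ^ 3 - E6 z ^ 2"
definition Deltaq :: "complex \<Rightarrow> complex" where "Deltaq w = E4q w ^ 3 - E6q w ^ 2"

lemma qexp_Delta: "qexp Delta Deltaq"
  unfolding Delta_def [abs_def] Deltaq_def [abs_def] power3_eq_cube power2_eq_square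
  by (intro qexp_diff qexp_mult qexp_E4 qexp_E6)

lemma Delta_modular: "Delta \<in> modular_forms 12"
proof -
  have "(\<lambda>z. E4 z ^ 3 + (- 1) * (E6 z ^ 2)) \<in> modular_forms 12"
  proof (rule modular_forms_add)
    show "(\<lambda>z. E4 z ^ 3) \<in> modular_forms 12"
      using modular_forms_power[OF E4_modular, of 3] by simp
    show "(\<lambda>z. (- 1) * (E6 z ^ 2)) \<in> modular_forms 12"
      using modular_forms_cmult[OF modular_forms_power[OF E6_modular, of 2], of "-1"] by simp
  qed
  then show ?thesis by (simp add: Delta_def [abs_def])
qed

lemma qderiv_has_field_derivative:
  assumes "f holomorphic_on uhp" "z \<in> uhp"
  shows "(f has_field_derivative 2 * of_real pi * \<i> * qderiv f z) (at z)"
  using holomorphic_derivI[OF assms(1) open_uhp assms(2)] by (simp add: qderiv_def)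

lemma Delta_has_field_derivative:
  assumes "z \<in> uhp"
  shows "(Delta has_field_derivative 2 * of_real pi * \<i> * (E2 z * Delta z)) (at z)"
proof -
  note d4 = qderiv_has_field_derivative[OF modular_forms_holomorphic[OF E4_modular] assms]
  note d6 = qderiv_has_field_derivative[OF modular_forms_holomorphic[OF E6_modular] assms]
  define P where "P = 2 * complex_of_real pi * \<i>"
  have "((\<lambda>z. E4 z ^ 3 - E6 z ^ 2) has_field_derivative
      3 * E4 z ^ 2 * (P * qderiv E4 z) - 2 * E6 z * (P * qderiv E6 z)) (at z)"
    unfolding P_def by (auto intro!: derivative_eq_intros d4 d6)
  moreover have "3 * E4 z ^ 2 * (P * qderiv E4 z) - 2 * E6 z * (P * qderiv E6 z) = P * (E2 z * Delta z)"
    unfolding qderiv_E4 qderiv_E6[OF assms] Delta_def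
    by (simp add: field_simps power2_eq_square power3_eq_cube)
  ultimately show ?thesis by (simp add: Delta_def [abs_def] P_def)
qed

text \<open>The equation \<open>Delta' = E2 * Delta\<close> is integrated directly. As
  \<open>E2 = 1 + q * S(q)\<close>, a primitive \<open>a\<close> of \<open>S\<close> on the disc
  accounts for the part beyond the constant term, which itself yields the factor \<open>q\<close>.
  This replaces the infinite product.\<close>

lemma Delta_product_form:
  obtains C a where "C \<noteq> 0" "a holomorphic_on ball 0 1"
    "\<And>z. z \<in> uhp \<Longrightarrow> Delta z = C * qpar z * exp (a (qpar z))"
proof -
  define S where "S = (\<lambda>w::complex. - 24 * (\<Sum>n. of_nat (divsum 1 (Suc n)) * w ^ n))"
  have "S holomorphic_on ball 0 1"
    unfolding S_def by (intro holomorphic_intros E2_series_holomorphic)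
  then obtain a where a: "\<And>w. w \<in> ball 0 1 \<Longrightarrow> (a has_field_derivative S w) (at w within ball 0 1)"
    using holomorphic_convex_primitive'[OF convex_ball open_ball] by blast
  have a': "(a has_field_derivative S w) (at w)" if "w \<in> ball 0 1" for w
    using a[OF that] at_within_open[OF that open_ball] by simp
  have E2S: "E2 z = 1 + qpar z * S (qpar z)" if "z \<in> uhp" for z
    using qexp_E2 that by (simp add: qexp_def E2q_def S_def)
  define P where "P = 2 * complex_of_real pi * \<i>"
  have "((\<lambda>z. Delta z * exp (- (a (qpar z) + P * z))) has_field_derivative 0) (at z within uhp)"
    if z: "z \<in> uhp" for z
  proof -
    have da: "((\<lambda>z. a (qpar z)) has_field_derivative S (qpar z) * (P * qpar z)) (at z)"
      unfolding P_def using DERIV_chain2[OF a'[OF qpar_in_ball[OF z]] has_field_derivative_qpar] .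
    have dd: "(Delta has_field_derivative P * (E2 z * Delta z)) (at z)"
      unfolding P_def by (rule Delta_has_field_derivative[OF z])
    have "((\<lambda>z. Delta z * exp (- (a (qpar z) + P * z))) has_field_derivative
       P * (E2 z * Delta z) * exp (- (a (qpar z) + P * z)) +
       exp (- (a (qpar z) + P * z)) * (- (S (qpar z) * (P * qpar z) + P)) * Delta z) (at z)"
      by (auto intro!: derivative_eq_intros da dd)
    moreover have "P * (E2 z * Delta z) * exp (- (a (qpar z) + P * z)) +
       exp (- (a (qpar z) + P * z)) * (- (S (qpar z) * (P * qpar z) + P)) * Delta z = 0"
      unfolding E2S[OF z] by (simp add: algebra_simps)
    ultimately show ?thesis by (simp only: has_field_derivative_at_within)
  qed
  from has_field_derivative_zero_constant[OF convex_uhp this]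
  obtain C where C: "\<And>z. z \<in> uhp \<Longrightarrow> Delta z * exp (- (a (qpar z) + P * z)) = C" by blast
  have form: "Delta z = C * qpar z * exp (a (qpar z))" if "z \<in> uhp" for z
  proof -
    have "Delta z = Delta z * (exp (- (a (qpar z) + P * z)) * exp (a (qpar z) + P * z))"
      unfolding exp_add[symmetric] by simp
    also have "\<dots> = C * exp (a (qpar z) + P * z)"
      unfolding mult.assoc[symmetric] C[OF that] ..
    also have "\<dots> = C * qpar z * exp (a (qpar z))" by (simp add: exp_add qpar_def P_def)
    finally show ?thesis .
  qed
  have "C \<noteq> 0"
  proof
    assume "C = 0"
    \<comment> \<open>If \<open>C\<close> were 0, \<open>Deltaq\<close> would vanish on the disc,
      while its derivative at 0 is \<open>3 * 240 + 2 * 504 = 1728\<close>.\<close>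
    have zero: "Deltaq w = 0" if "w \<in> ball 0 1" for w
    proof (cases "w = 0")
      case True
      then show ?thesis by (simp add: Deltaq_def E4q_0 E6q_0)
    next
      case False
      have "norm w < 1" using that by simp
      note q = qpar_Ln[OF False this]
      have "Delta (Ln w / (2 * of_real pi * \<i>)) = Deltaq (qpar (Ln w / (2 * of_real pi * \<i>)))"
        using qexp_Delta q(2) by (simp only: qexp_def)
      then show ?thesis using form[OF q(2)] \<open>C = 0\<close> by (simp only: q(1) mult_zero_left)
    qed
    have h: "E4q holomorphic_on ball 0 1" "E6q holomorphic_on ball 0 1"
      using qexp_E4 qexp_E6 by (simp_all add: qexp_def)
    have "(E4q has_field_derivative 240) (at 0)" "(E6q has_field_derivative - 504) (at 0)"
      using holomorphic_derivI[OF h(1), of 0] holomorphic_derivI[OF h(2), of 0]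
      by (simp_all add: deriv_E4q_0 deriv_E6q_0)
    then have "(Deltaq has_field_derivative 1728) (at 0)"
      unfolding Deltaq_def [abs_def] by (auto intro!: derivative_eq_intros simp: E4q_0 E6q_0)
    moreover have "(Deltaq has_field_derivative 0) (at 0)"
      by (rule has_field_derivative_transform_within_open[OF DERIV_const[of 0], where S = "ball 0 1"])
         (auto simp: zero)
    ultimately show False using DERIV_unique by fastforce
  qed
  moreover have "a holomorphic_on ball 0 1"
    using a' unfolding holomorphic_on_open[OF open_ball] by blast
  ultimately show ?thesis using form by (rule that)
qed

lemma Delta_nonzero: "z \<in> uhp \<Longrightarrow> Delta z \<noteq> 0"
  by (rule Delta_product_form) simp

text \<open>The product form shows that \<open>Delta\<close> has a simple zero at
  \<open>q = 0\<close> and no other zero, so the zero of \<open>F\<close> cancels it and the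
  quotient is holomorphic at the cusp too.\<close>

lemma cusp_form_divide_Delta:
  assumes f: "f \<in> modular_forms w" and F: "qexp f F" "F 0 = 0" and w: "w \<ge> 12"
  obtains g where "g \<in> modular_forms (w - 12)" "\<And>z. z \<in> uhp \<Longrightarrow> f z = Delta z * g z"
proof -
  obtain G where G: "G holomorphic_on ball 0 1" "\<And>w. w \<in> ball 0 1 \<Longrightarrow> F w = w * G w"
    using holomorphic_factor_zero_at_0 F unfolding qexp_def by metis
  obtain C a where C: "C \<noteq> 0" "a holomorphic_on ball 0 1"
    "\<And>z. z \<in> uhp \<Longrightarrow> Delta z = C * qpar z * exp (a (qpar z))"
    using Delta_product_form by metis
  define g where "g = (\<lambda>z. f z / Delta z)"
  have "qexp g (\<lambda>w. G w / (C * exp (a w)))"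
    unfolding qexp_def
  proof (intro conjI ballI)
    show "(\<lambda>w. G w / (C * exp (a w))) holomorphic_on ball 0 1"
      using C by (auto intro!: holomorphic_intros G(1))
    fix z assume z: "z \<in> uhp"
    have "f z = qpar z * G (qpar z)" using F(1) G(2)[OF qpar_in_ball[OF z]] z by (simp add: qexp_def)
    then show "g z = G (qpar z) / (C * exp (a (qpar z)))"
      using C(1) by (simp add: g_def C(3)[OF z])
  qed
  then have "g \<in> modular_forms (w - 12)"
  proof (rule modular_formsI)
    fix a b c d :: int and z assume det: "a * d - b * c = 1" and z: "z \<in> uhp"
    define J where "J = of_int c * z + of_int d"
    have J: "J \<noteq> 0" unfolding J_def by (rule mob_denom_nonzero[OF det z])
    have "J ^ w = J ^ (w - 12) * J ^ 12" using w by (simp add: power_add[symmetric])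
    then show "g (mob a b c d z) = (of_int c * z + of_int d) ^ (w - 12) * g z"
      unfolding g_def modular_forms_mob[OF f det z] modular_forms_mob[OF Delta_modular det z] J_def[symmetric]
      using J by simp
  qed
  moreover have "f z = Delta z * g z" if "z \<in> uhp" for z
    using Delta_nonzero[OF that] by (simp add: g_def)
  ultimately show ?thesis by (rule that)
qed

text \<open>Division by \<open>Delta\<close> is repeated until the constant term is nonzero; it
  lowers \<open>n\<close> by 6 and is always possible because cusp forms with \<open>n <= 5\<close>
  vanish. The clause \<open>v > 0\<close> later ensures that a reduction makes strict
  progress.\<close>

lemma modular_form_Delta_decomposition:
  assumes "f \<in> modular_forms (2 * n)" "qexp f F" "z0 \<in> uhp" "f z0 \<noteq> 0"
  shows "\<exists>v g G. 6 * v \<le> n \<and> (F 0 = 0 \<longrightarrow> v > 0) \<and> g \<in> modular_forms (2 * (n - 6 * v)) \<and> qexp g G \<and> G 0 \<noteq> 0 \<and>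
    (\<forall>z\<in>uhp. f z = Delta z ^ v * g z)"
  using assms
proof (induction n arbitrary: f F rule: less_induct)
  case (less n)
  show ?case
  proof (cases "F 0 = 0")
    case False
    then show ?thesis using less.prems by (intro exI[of _ 0] exI[of _ f] exI[of _ F]) simp
  next
    case True
    have n: "n \<ge> 6"
    proof (rule ccontr)
      assume "\<not> n \<ge> 6"
      then have "n \<le> 5" by simp
      from cusp_form_zero[OF less.prems(1) this less.prems(2) True less.prems(3)] less.prems(4)
      show False by simp
    qed
    then obtain h where h: "h \<in> modular_forms (2 * n - 12)" "\<And>z. z \<in> uhp \<Longrightarrow> f z = Delta z * h z"
      using cusp_form_divide_Delta[OF less.prems(1,2) True] by auto
    obtain H where H: "qexp h H" using modular_forms_qexp[OF h(1)] .
    have "h \<in> modular_forms (2 * (n - 6))" using h(1) by (simp add: diff_mult_distrib2)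
    moreover have "h z0 \<noteq> 0" using h(2)[OF less.prems(3)] less.prems(4) by auto
    ultimately obtain v g G where g: "6 * v \<le> n - 6" "g \<in> modular_forms (2 * (n - 6 - 6 * v))"
        "qexp g G" "G 0 \<noteq> 0" "\<forall>z\<in>uhp. h z = Delta z ^ v * g z"
      using less.IH[of "n - 6" h H] n H less.prems(3) by auto
    show ?thesis
      using g n h(2) by (intro exI[of _ "Suc v"] exI[of _ g] exI[of _ G]) (auto simp: algebra_simps)
  qed
qed

text \<open>\<open>E4^n\<close> and \<open>E4^m * E6\<close> have the weights \<open>4 n\<close> and
  \<open>4 m + 6\<close>, which are all even weights other than 2.\<close>

lemma normalized_modular_form_exists:
  assumes "u \<noteq> 1"
  obtains e E where "e \<in> modular_forms (2 * u)" "qexp e E" "E 0 = 1"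
proof -
  have P: "qexp (\<lambda>z. E4 z ^ n) (\<lambda>w. E4q w ^ n)" for n
    using qexp_E4 by (auto simp: qexp_def intro!: holomorphic_intros)
  show ?thesis
  proof (cases "even u")
    case True
    then obtain n where "u = 2 * n" by (rule evenE)
    then show ?thesis
      using that[of "\<lambda>z. E4 z ^ n", OF _ P[of n]] modular_forms_power[OF E4_modular, of n] by (simp add: E4q_0)
  next
    case False
    then obtain n where n: "u = 2 * n + 1" by (rule oddE)
    with assms obtain m where "n = Suc m" by (cases n) auto
    with n have "4 * m + 6 = 2 * u" by simp
    then show ?thesis
      using that[of "\<lambda>z. E4 z ^ m * E6 z", OF _ qexp_mult[OF P[of m] qexp_E6]]
        modular_forms_mult[OF modular_forms_power[OF E4_modular, of m] E6_modular] by (simp add: E4q_0 E6q_0)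
  qed
qed

section \<open>A Noetherian property\<close>

text \<open>Modular forms of weight \<open>2 n\<close>; negative weights are allowed so that spans of shifted generators
  need no case distinction.\<close>

definition MF :: "int \<Rightarrow> (complex \<Rightarrow> complex) set" where
  "MF n = (if n < 0 then {f. \<forall>z\<in>uhp. f z = 0} else modular_forms (2 * nat n))"

lemma MF_nat [simp]: "MF (int n) = modular_forms (2 * n)"
  by (simp add: MF_def)

lemma MF_cong: "f \<in> MF n \<Longrightarrow> (\<And>z. z \<in> uhp \<Longrightarrow> g z = f z) \<Longrightarrow> g \<in> MF n"
  by (auto simp: MF_def intro: modular_forms_cong split: if_splits)

lemma MF_zero: "(\<And>z. z \<in> uhp \<Longrightarrow> f z = 0) \<Longrightarrow> f \<in> MF n"
  by (auto simp: MF_def intro: modular_forms_cong[OF modular_forms_zero])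

lemma MF_neg: "f \<in> MF n \<Longrightarrow> n < 0 \<Longrightarrow> z \<in> uhp \<Longrightarrow> f z = 0"
  by (simp add: MF_def)

lemma MF_add: "f \<in> MF n \<Longrightarrow> g \<in> MF n \<Longrightarrow> (\<lambda>z. f z + g z) \<in> MF n"
  by (auto simp: MF_def intro: modular_forms_add)

lemma MF_mult:
  assumes "f \<in> MF m" "g \<in> MF n"
  shows "(\<lambda>z. f z * g z) \<in> MF (m + n)"
proof (cases "m < 0 \<or> n < 0")
  case True
  then show ?thesis using MF_neg assms by (intro MF_zero) auto
next
  case False
  then show ?thesis using modular_forms_mult assms by (auto simp: MF_def nat_add_distrib distrib_left)
qed

lemma MF_const: "(\<lambda>_. c) \<in> MF 0"
  by (simp add: MF_def modular_forms_const)

lemma MF_cmult: "f \<in> MF n \<Longrightarrow> (\<lambda>z. c * f z) \<in> MF n"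
  using MF_mult[OF MF_const] by simp

lemma MF_minus: "f \<in> MF n \<Longrightarrow> (\<lambda>z. - f z) \<in> MF n"
  using MF_cmult[of f n "-1"] by simp

lemma MF_diff: "f \<in> MF n \<Longrightarrow> g \<in> MF n \<Longrightarrow> (\<lambda>z. f z - g z) \<in> MF n"
  using MF_add[OF _ MF_minus] by simp

lemma MF_sum: "(\<And>i. i \<in> A \<Longrightarrow> f i \<in> MF n) \<Longrightarrow> (\<lambda>z. \<Sum>i\<in>A. f i z) \<in> MF n"
  by (induction A rule: infinite_finite_induct) (auto intro: MF_zero MF_add)

lemma MF_holomorphic: "f \<in> MF n \<Longrightarrow> f holomorphic_on uhp"
  by (cases "n < 0") (auto simp: MF_def intro: modular_forms_holomorphic holomorphic_transform[OF holomorphic_on_const])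

section \<open>Dickson's lemma\<close>

lemma strict_mono_nat_subseq:
  fixes s :: "nat \<Rightarrow> nat"
  obtains f :: "nat \<Rightarrow> nat" where "strict_mono f" "\<And>m n. m \<le> n \<Longrightarrow> s (f m) \<le> s (f n)"
proof -
  obtain f :: "nat \<Rightarrow> nat" where f: "strict_mono f" "monoseq (\<lambda>n. s (f n))" using seq_monosub by blast
  show ?thesis
  proof (cases "\<forall>m n. m \<le> n \<longrightarrow> s (f m) \<le> s (f n)")
    case True
    then show ?thesis using f that by blast
  next
    case False
    \<comment> \<open>A decreasing sequence of natural numbers is constant from its minimum on, so
      its tail is also increasing.\<close>
    then have dec: "s (f n) \<le> s (f m)" if "m \<le> n" for m n
      using f(2) that unfolding monoseq_def by blast
    define N where "N = arg_min (\<lambda>n. s (f n)) (\<lambda>_. True)"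
    have N: "s (f N) \<le> s (f n)" for n unfolding N_def by (rule arg_min_nat_le) simp
    have "s (f (N + n)) = s (f N)" for n using N[of "N + n"] dec[of N "N + n"] by simp
    moreover have "strict_mono (\<lambda>n. f (N + n))" using f(1) by (simp add: strict_mono_def)
    ultimately show ?thesis using that[of "\<lambda>n. f (N + n)"] by simp
  qed
qed

text \<open>The difference \<open>1\<close> is excluded because no modular form of weight 2 is available as a multiplier.\<close>

lemma dickson_parity:
  fixes i v u :: "nat \<Rightarrow> nat"
  assumes "\<And>m. i m < r"
  obtains j m where "j < m" "i j = i m" "v j \<le> v m" "u j \<le> u m" "u m - u j \<noteq> 1"
proof -
  \<comment> \<open>Fixing the parity of \<open>u\<close> along with the index makes all later
    differences of \<open>u\<close> even, hence different from 1.\<close>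
  have "range (\<lambda>m. (i m, u m mod 2)) \<subseteq> {..<r} \<times> {..<2}" using assms by auto
  then have "finite (range (\<lambda>m. (i m, u m mod 2)))" by (rule finite_subset) simp
  from pigeonhole_infinite[OF infinite_UNIV_nat this]
  obtain m0 where inf: "infinite {m. (i m, u m mod 2) = (i m0, u m0 mod 2)}" by auto
  define s where "s = enumerate {m. (i m, u m mod 2) = (i m0, u m0 mod 2)}"
  have s: "strict_mono s" "\<And>n. i (s n) = i m0" "\<And>n. u (s n) mod 2 = u m0 mod 2"
    using strict_mono_enumerate[OF inf] enumerate_in_set[OF inf] unfolding s_def by auto
  obtain f :: "nat \<Rightarrow> nat" where f: "strict_mono f" "\<And>m n. m \<le> n \<Longrightarrow> v (s (f m)) \<le> v (s (f n))"
    using strict_mono_nat_subseq[of "\<lambda>n. v (s n)"] by blast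
  obtain g :: "nat \<Rightarrow> nat" where g: "strict_mono g" "\<And>m n. m \<le> n \<Longrightarrow> u (s (f (g m))) \<le> u (s (f (g n)))"
    using strict_mono_nat_subseq[of "\<lambda>n. u (s (f n))"] by blast
  show ?thesis
  proof (rule that[of "s (f (g 0))" "s (f (g 1))"])
    have "g 0 < g 1" using g(1) by (simp add: strict_mono_def)
    then show "s (f (g 0)) < s (f (g 1))" "v (s (f (g 0))) \<le> v (s (f (g 1)))"
      using f s(1) by (simp_all add: strict_mono_def)
    show "u (s (f (g 1))) - u (s (f (g 0))) \<noteq> 1"
      using s(3)[of "f (g 0)"] s(3)[of "f (g 1)"] by presburger
  qed (use s(2) g(2) in auto)
qed

text \<open>\<open>lead_data s d r x i v u\<close> records the leading term of a vector \<open>x\<close> of modular forms: \<open>i\<close> is the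
  first nonzero entry and \<open>v\<close> is its order at the cusp. The entry then has weight \<open>2 (u + 6 v)\<close>.\<close>

definition lead_data :: "int \<Rightarrow> (nat \<Rightarrow> int) \<Rightarrow> nat \<Rightarrow> (nat \<Rightarrow> complex \<Rightarrow> complex) \<Rightarrow> nat \<Rightarrow> nat \<Rightarrow> nat \<Rightarrow> bool" where
  "lead_data s d r x i v u \<longleftrightarrow> i < r \<and> (\<forall>i'<i. \<forall>z\<in>uhp. x i' z = 0) \<and> int (u + 6 * v) = s - d i \<and>
     (\<exists>z\<in>uhp. x i z \<noteq> 0) \<and>
     (\<exists>g G. g \<in> modular_forms (2 * u) \<and> qexp g G \<and> G 0 \<noteq> 0 \<and> (\<forall>z\<in>uhp. x i z = Delta z ^ v * g z))"

section \<open>Leading terms and their comparison\<close>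

lemma lead_data_exists:
  assumes x: "\<And>i. i < r \<Longrightarrow> x i \<in> MF (s - d i)" and nz: "i0 < r" "z0 \<in> uhp" "x i0 z0 \<noteq> 0"
  obtains i v u where "lead_data s d r x i v u"
proof -
  define i where "i = (LEAST i. \<exists>z\<in>uhp. x i z \<noteq> 0)"
  have ex: "\<exists>z\<in>uhp. x i z \<noteq> 0" unfolding i_def by (rule LeastI_ex) (use nz in blast)
  have "i \<le> i0" unfolding i_def by (rule Least_le) (use nz in blast)
  then have ir: "i < r" using nz(1) by simp
  have less: "x i' z = 0" if "i' < i" "z \<in> uhp" for i' z
    using not_less_Least[of i' "\<lambda>i. \<exists>z\<in>uhp. x i z \<noteq> 0"] that unfolding i_def by blast
  obtain z where z: "z \<in> uhp" "x i z \<noteq> 0" using ex by blast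
  have "\<not> s - d i < 0" using MF_neg[OF x[OF ir]] z by blast
  then obtain n where n: "s - d i = int n" by (metis nonneg_int_cases not_less)
  have xi: "x i \<in> modular_forms (2 * n)" using x[OF ir] n by simp
  obtain F where F: "qexp (x i) F" using modular_forms_qexp[OF xi] .
  obtain v g G where g: "6 * v \<le> n" "g \<in> modular_forms (2 * (n - 6 * v))" "qexp g G" "G 0 \<noteq> 0"
    "\<forall>z\<in>uhp. x i z = Delta z ^ v * g z"
    using modular_form_Delta_decomposition[OF xi F z] by blast
  have "lead_data s d r x i v (n - 6 * v)"
    unfolding lead_data_def using ir less ex n g by auto
  then show ?thesis by (rule that)
qed

text \<open>When the cofactor \<open>g\<close> vanishes at the cusp, either it is divisible by
  \<open>Delta\<close>, which raises the order, or the whole entry is zero and the leading index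
  moves on.\<close>

lemma lead_data_increase:
  assumes x: "\<And>i. i < r \<Longrightarrow> x i \<in> MF (s - d i)" and nz: "i0 < r" "z0 \<in> uhp" "x i0 z0 \<noteq> 0"
    and i: "i < r" "\<And>i' z. i' < i \<Longrightarrow> z \<in> uhp \<Longrightarrow> x i' z = 0" "int (u + 6 * v) = s - d i"
    and g: "g \<in> modular_forms (2 * u)" "qexp g G" "G 0 = 0" "\<And>z. z \<in> uhp \<Longrightarrow> x i z = Delta z ^ v * g z"
  obtains i' v' u' where "lead_data s d r x i' v' u'" "i' > i \<or> i' = i \<and> v' > v"
proof (cases "\<exists>z\<in>uhp. x i z \<noteq> 0")
  case True
  then obtain z where z: "z \<in> uhp" "x i z \<noteq> 0" by blast
  then have "g z \<noteq> 0" using g(4)[OF z(1)] by auto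
  from modular_form_Delta_decomposition[OF g(1,2) z(1) this] obtain k h H where
    h: "6 * k \<le> u" "k > 0" "h \<in> modular_forms (2 * (u - 6 * k))" "qexp h H" "H 0 \<noteq> 0"
    "\<forall>z\<in>uhp. g z = Delta z ^ k * h z" using g(3) by auto
  have "lead_data s d r x i (v + k) (u - 6 * k)"
  proof -
    have "\<forall>z\<in>uhp. x i z = Delta z ^ (v + k) * h z"
      using g(4) h(6) by (simp add: power_add)
    then have "\<exists>g G. g \<in> modular_forms (2 * (u - 6 * k)) \<and> qexp g G \<and> G 0 \<noteq> 0 \<and> (\<forall>z\<in>uhp. x i z = Delta z ^ (v + k) * g z)"
      using h(3-5) by blast
    moreover have "int (u - 6 * k + 6 * (v + k)) = s - d i" using i(3) h(1) by simp
    ultimately show ?thesis unfolding lead_data_def using i(1,2) True by blast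
  qed
  then show ?thesis using h(2) by (intro that) auto
next
  case False
  obtain i' v' u' where l: "lead_data s d r x i' v' u'"
    using lead_data_exists[where r = r and x = x and s = s and d = d, OF x nz] by blast
  have "\<not> i' < i" using l i(2) unfolding lead_data_def by blast
  moreover have "i' \<noteq> i" using l False unfolding lead_data_def by blast
  ultimately show ?thesis using l by (intro that) auto
qed

text \<open>The weight bounds the order at the cusp, so only finitely many pairs
  \<open>(i, v)\<close> occur. They are compared lexicographically by the single number
  \<open>key\<close>, in which \<open>v <= B\<close> serves as the last digit in base
  \<open>B + 1\<close>.\<close>

lemma lead_data_maximal:
  assumes "lead_data s d r x0 i0 v0 u0" "x0 \<in> C"
  obtains x i v u where "x \<in> C" "lead_data s d r x i v u"
    "\<And>x' i' v' u'. x' \<in> C \<Longrightarrow> lead_data s d r x' i' v' u' \<Longrightarrow> \<not> (i' > i \<or> i' = i \<and> v' > v)"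
proof -
  define B where "B = (\<Sum>i<r. nat (s - d i))"
  define key where "key = (\<lambda>(x :: nat \<Rightarrow> complex \<Rightarrow> complex, i, v, u::nat). i * (B + 1) + v)"
  define P where "P = (\<lambda>(x, i, v, u). x \<in> C \<and> lead_data s d r x i v u)"
  have vB: "v \<le> B" if "lead_data s d r x i v u" for x i v u
  proof -
    have "v \<le> nat (s - d i)" "i < r" using that by (auto simp: lead_data_def)
    moreover have "nat (s - d i) \<le> B" unfolding B_def using \<open>i < r\<close> by (intro member_le_sum) auto
    ultimately show ?thesis by simp
  qed
  have bound: "key p < (r + 1) * (B + 1)" if "P p" for p
  proof -
    obtain x i v u where p: "p = (x, i, v, u)" by (metis surj_pair)
    have l: "lead_data s d r x i v u" using that by (simp add: P_def p)
    then have "i < r" by (simp add: lead_data_def)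
    then have "i * (B + 1) \<le> r * (B + 1)" by (intro mult_right_mono) auto
    then show ?thesis using vB[OF l] by (simp add: p key_def)
  qed
  have "P (x0, i0, v0, u0)" using assms by (simp add: P_def)
  then obtain p where p: "P p" "\<And>p'. P p' \<Longrightarrow> key p' \<le> key p"
    using ex_has_greatest_nat[of P _ key "(r + 1) * (B + 1)"] bound by (metis less_imp_le_nat)
  obtain x i v u where p_eq: "p = (x, i, v, u)" by (metis surj_pair)
  show ?thesis
  proof (rule that)
    show "x \<in> C" "lead_data s d r x i v u" using p(1) by (simp_all add: P_def p_eq)
    fix x' i' v' u' assume "x' \<in> C" and l: "lead_data s d r x' i' v' u'"
    then have le: "i' * (B + 1) + v' \<le> i * (B + 1) + v"
      using p(2)[of "(x', i', v', u')"] by (simp add: P_def p_eq key_def)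
    show "\<not> (i' > i \<or> i' = i \<and> v' > v)"
    proof
      assume "i' > i \<or> i' = i \<and> v' > v"
      then show False
      proof
        assume "i' > i"
        then have "(i + 1) * (B + 1) \<le> i' * (B + 1)" by (intro mult_right_mono) auto
        then show False using le vB \<open>lead_data s d r x i v u\<close> by fastforce
      qed (use le in auto)
    qed
  qed
qed

text \<open>In each coset \<open>C m\<close> of \<open>h m\<close> modulo the span of the previous vectors, a vector with largest leading
  data is chosen. A divisibility among the leading data would allow a further reduction.\<close>

lemma MF_noetherian:
  fixes h :: "nat \<Rightarrow> nat \<Rightarrow> complex \<Rightarrow> complex" and w d :: "nat \<Rightarrow> int"
  assumes h: "\<And>m i. i < r \<Longrightarrow> h m i \<in> MF (w m - d i)"
  obtains m c where "\<And>j. j < m \<Longrightarrow> c j \<in> MF (w m - w j)"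
    "\<And>i z. i < r \<Longrightarrow> z \<in> uhp \<Longrightarrow> h m i z = (\<Sum>j<m. c j z * h j i z)"
proof (rule ccontr)
  assume "\<not> thesis"
  note contr = this and goal = that
  define R where "R = (\<lambda>m x c. (\<forall>j<m. c j \<in> MF (w m - w j)) \<and>
    (\<forall>i<r. \<forall>z\<in>uhp. x i z = h m i z - (\<Sum>j<m. c j z * h j i z)))"
  define C where "C = (\<lambda>m. {x. \<exists>c. R m x c})"
  \<comment> \<open>A zero vector in the coset would express \<open>h m\<close> by its predecessors,
    which is the negated goal.\<close>
  have nonzero: "\<exists>i<r. \<exists>z\<in>uhp. x i z \<noteq> 0" if "x \<in> C m" for m x
  proof (rule ccontr)
    assume "\<not> ?thesis"
    then have 0: "x i z = 0" if "i < r" "z \<in> uhp" for i z using that by blast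
    obtain c where c: "R m x c" using \<open>x \<in> C m\<close> by (auto simp: C_def)
    have "h m i z = (\<Sum>j<m. c j z * h j i z)" if "i < r" "z \<in> uhp" for i z
      using c 0[OF that] that unfolding R_def by simp
    then show False using contr goal[of m c] c unfolding R_def by blast
  qed
  have comp: "x i \<in> MF (w m - d i)" if x: "x \<in> C m" and i: "i < r" for m x i
  proof -
    obtain c where c: "R m x c" using x by (auto simp: C_def)
    have t: "(\<lambda>z. c j z * h j i z) \<in> MF (w m - d i)" if "j < m" for j
      using MF_mult[of "c j" "w m - w j" "h j i" "w j - d i"] c that h[OF i] by (simp add: R_def)
    have "(\<lambda>z. h m i z - (\<Sum>j<m. c j z * h j i z)) \<in> MF (w m - d i)"
      by (intro MF_diff MF_sum h i) (use t in auto)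
    then show ?thesis by (rule MF_cong) (use c i in \<open>auto simp: R_def\<close>)
  qed
  have "\<exists>x i v u. x \<in> C m \<and> lead_data (w m) d r x i v u \<and>
    (\<forall>x' i' v' u'. x' \<in> C m \<longrightarrow> lead_data (w m) d r x' i' v' u' \<longrightarrow> \<not> (i' > i \<or> i' = i \<and> v' > v))" for m
  proof -
    have "R m (h m) (\<lambda>j z. 0)" by (simp add: R_def MF_zero)
    then have hC: "h m \<in> C m" by (auto simp: C_def)
    obtain i z where iz: "i < r" "z \<in> uhp" "h m i z \<noteq> 0" using nonzero[OF hC] by blast
    obtain i v u where "lead_data (w m) d r (h m) i v u"
      using lead_data_exists[where r = r and x = "h m" and s = "w m" and d = d, OF comp[OF hC] iz] by blast
    from lead_data_maximal[OF this hC] show ?thesis by metis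
  qed
  then obtain x i v u where x: "\<And>m. x m \<in> C m" and lead: "\<And>m. lead_data (w m) d r (x m) (i m) (v m) (u m)"
    and max: "\<And>m x' i' v' u'. x' \<in> C m \<Longrightarrow> lead_data (w m) d r x' i' v' u' \<Longrightarrow> \<not> (i' > i m \<or> i' = i m \<and> v' > v m)"
    by metis
  have ir: "i m < r" for m using lead[of m] by (simp add: lead_data_def)
  obtain j m where jm: "j < m" "i j = i m" "v j \<le> v m" "u j \<le> u m" "u m - u j \<noteq> 1"
    using dickson_parity[of i r v u] ir by blast
  obtain g G where g: "g \<in> modular_forms (2 * u m)" "qexp g G" "G 0 \<noteq> 0" "\<And>z. z \<in> uhp \<Longrightarrow> x m (i m) z = Delta z ^ v m * g z"
    using lead[of m] unfolding lead_data_def by blast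
  obtain g' G' where g': "g' \<in> modular_forms (2 * u j)" "qexp g' G'" "G' 0 \<noteq> 0" "\<And>z. z \<in> uhp \<Longrightarrow> x j (i m) z = Delta z ^ v j * g' z"
    using lead[of j] unfolding lead_data_def jm(2) by blast
  obtain e E where e: "e \<in> modular_forms (2 * (u m - u j))" "qexp e E" "E 0 = 1"
    using normalized_modular_form_exists[OF jm(5)] by blast
  \<comment> \<open>The multiplier makes up the difference in weight and order between the two
    leading entries, and the ratio of constants makes their leading coefficients agree.\<close>
  define t where "t = (\<lambda>z. G 0 / G' 0 * (Delta z ^ (v m - v j) * e z))"
  have ws: "int (u m + 6 * v m) = w m - d (i m)" "int (u j + 6 * v j) = w j - d (i m)"
    using lead[of m] lead[of j] by (auto simp: lead_data_def jm(2))
  have t: "t \<in> MF (w m - w j)"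
  proof -
    have "(\<lambda>z. Delta z ^ (v m - v j) * e z) \<in> modular_forms (12 * (v m - v j) + 2 * (u m - u j))"
      by (rule modular_forms_mult[OF modular_forms_power[OF Delta_modular] e(1)])
    moreover have "12 * (v m - v j) + 2 * (u m - u j) = 2 * (6 * (v m - v j) + (u m - u j))" by simp
    moreover have "w m - w j = int (6 * (v m - v j) + (u m - u j))"
      using ws jm by (simp add: of_nat_diff)
    ultimately show ?thesis unfolding t_def by (simp only: MF_nat) (rule modular_forms_cmult)
  qed
  obtain c where c: "R m (x m) c" using x[of m] by (auto simp: C_def)
  obtain c' where c': "R j (x j) c'" using x[of j] by (auto simp: C_def)
  define y where "y = (\<lambda>i z. x m i z - t z * x j i z)"
  \<comment> \<open>Subtracting \<open>t * x j\<close> uses \<open>h j\<close> itself and, through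
    the coefficients \<open>c'\<close>, the vectors before it, so the result stays in the coset of
    \<open>h m\<close>.\<close>
  define b where "b = (\<lambda>l z. c l z + (if l = j then t z else if l < j then - (t z * c' l z) else 0))"
  have "R m y b"
    unfolding R_def
  proof (intro conjI allI impI ballI)
    fix l assume l: "l < m"
    have cl: "c l \<in> MF (w m - w l)" using c l by (simp add: R_def)
    consider "l = j" | "l < j" | "l > j" by linarith
    then show "b l \<in> MF (w m - w l)"
    proof cases
      case 1
      then show ?thesis using MF_add[OF cl, of t] t by (simp add: b_def)
    next
      case 2
      then have "(\<lambda>z. t z * c' l z) \<in> MF (w m - w l)"
        using MF_mult[OF t, of "c' l" "w j - w l"] c' by (simp add: R_def)
      then show ?thesis using MF_diff[OF cl, of "\<lambda>z. t z * c' l z"] 2 by (simp add: b_def)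
    next
      case 3
      then show ?thesis using cl by (simp add: b_def)
    qed
  next
    fix i z assume i: "i < r" and z: "z \<in> uhp"
    have xm: "x m i z = h m i z - (\<Sum>l<m. c l z * h l i z)" and xj: "x j i z = h j i z - (\<Sum>l<j. c' l z * h l i z)"
      using c c' i z by (simp_all add: R_def)
    have "(\<Sum>l<m. (if l = j then t z else if l < j then - (t z * c' l z) else 0) * h l i z)
       = (\<Sum>l\<in>insert j {..<j}. (if l = j then t z else if l < j then - (t z * c' l z) else 0) * h l i z)"
      using jm(1) by (intro sum.mono_neutral_right) auto
    also have "\<dots> = t z * h j i z + (\<Sum>l<j. - (t z * c' l z) * h l i z)" by simp
    also have "\<dots> = t z * x j i z" by (simp add: xj sum_negf sum_distrib_left algebra_simps)
    finally show "y i z = h m i z - (\<Sum>l<m. b l z * h l i z)"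
      by (simp add: y_def b_def xm distrib_right sum.distrib)
  qed
  then have yC: "y \<in> C m" by (auto simp: C_def)
  obtain i0 z0 where iz: "i0 < r" "z0 \<in> uhp" "y i0 z0 \<noteq> 0" using nonzero[OF yC] by blast
  \<comment> \<open>The cofactor of the new leading entry. Since \<open>E 0 = 1\<close>, its
    constant term is \<open>G 0 - G 0 / G' 0 * G' 0 = 0\<close>.\<close>
  define k where "k = (\<lambda>z. g z - G 0 / G' 0 * (e z * g' z))"
  have k: "k \<in> modular_forms (2 * u m)"
  proof -
    have "(\<lambda>z. e z * g' z) \<in> modular_forms (2 * (u m - u j) + 2 * u j)"
      by (rule modular_forms_mult[OF e(1) g'(1)])
    then have "(\<lambda>z. e z * g' z) \<in> modular_forms (2 * u m)" using jm(4) by (simp add: distrib_left[symmetric])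
    from modular_forms_add[OF g(1) modular_forms_cmult[OF this, of "- (G 0 / G' 0)"]]
    show ?thesis by (simp add: k_def)
  qed
  have qk: "qexp k (\<lambda>w. G w - G 0 / G' 0 * (E w * G' w))"
    unfolding k_def by (intro qexp_diff qexp_mult qexp_const g g' e)
  have yi: "y (i m) z = Delta z ^ v m * k z" if z: "z \<in> uhp" for z
  proof -
    have "Delta z ^ v m = Delta z ^ (v m - v j) * Delta z ^ v j"
      using jm(3) by (simp add: power_add[symmetric])
    then show ?thesis by (simp add: y_def t_def k_def g(4)[OF z] g'(4)[OF z] algebra_simps)
  qed
  have y0: "y i' z = 0" if "i' < i m" "z \<in> uhp" for i' z
    using lead[of m] lead[of j] that by (simp add: y_def lead_data_def jm(2))
  obtain i' v' u' where "lead_data (w m) d r y i' v' u'" "i' > i m \<or> i' = i m \<and> v' > v m"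
    using lead_data_increase[where r = r and x = y and s = "w m" and d = d, OF comp[OF yC] iz ir y0 ws(1) k qk _ yi]
      e(3) g'(3) by auto
  then show False using max[OF yC] by blast
qed

section \<open>Modules stable under the Serre derivative\<close>

lemma Dop_cong:
  assumes "\<And>z. z \<in> uhp \<Longrightarrow> f z = g z" "z \<in> uhp"
  shows "Dop k f z = Dop k g z"
proof -
  have "deriv f z = deriv g z"
    by (rule deriv_cong_ev) (use assms eventually_nhds_in_open[OF open_uhp assms(2)] in \<open>auto elim!: eventually_mono\<close>)
  then show ?thesis using assms by (simp add: Dop_def qderiv_def)
qed

lemma holomorphic_on_Dop: "f holomorphic_on uhp \<Longrightarrow> Dop k f holomorphic_on uhp"
  unfolding Dop_def [abs_def] qderiv_def
  by (intro holomorphic_intros qexp_holomorphic[OF qexp_E2] open_uhp) auto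

lemma holomorphic_uhp_deriv:
  "f holomorphic_on uhp \<Longrightarrow> z \<in> uhp \<Longrightarrow> (f has_field_derivative deriv f z) (at z)"
  by (rule holomorphic_derivI[OF _ open_uhp])

lemma Dop_mult:
  assumes "f holomorphic_on uhp" "g holomorphic_on uhp" "z \<in> uhp"
  shows "Dop (k + l) (\<lambda>z. f z * g z) z = Dop k f z * g z + f z * Dop l g z"
proof -
  have "deriv (\<lambda>z. f z * g z) z = deriv f z * g z + deriv g z * f z"
    by (intro DERIV_imp_deriv DERIV_mult holomorphic_uhp_deriv assms)
  then show ?thesis
    by (simp add: Dop_def qderiv_def add_divide_distrib algebra_simps)
qed

lemma Dop_sum:
  assumes "finite A" "\<And>i. i \<in> A \<Longrightarrow> f i holomorphic_on uhp" "z \<in> uhp"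
  shows "Dop k (\<lambda>z. \<Sum>i\<in>A. f i z) z = (\<Sum>i\<in>A. Dop k (f i) z)"
proof -
  have "deriv (\<lambda>z. \<Sum>i\<in>A. f i z) z = (\<Sum>i\<in>A. deriv (f i) z)"
    by (intro DERIV_imp_deriv DERIV_sum holomorphic_uhp_deriv assms)
  then show ?thesis
    by (simp add: Dop_def qderiv_def sum_divide_distrib sum_distrib_left sum_subtractf)
qed

lemma MF_Dop:
  assumes "f \<in> MF n"
  shows "Dop (2 * of_int n) f \<in> MF (n + 1)"
proof (cases "n < 0")
  case True
  have "Dop (2 * of_int n) f z = 0" if "z \<in> uhp" for z
    using Dop_cong[of f "\<lambda>_. 0" z "2 * of_int n"] MF_neg[OF assms True] that
    by (simp add: Dop_def qderiv_def)
  then show ?thesis by (rule MF_zero)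
next
  case False
  then obtain m where m: "n = int m" by (metis nonneg_int_cases not_less)
  have "Dop (real (2 * m)) f \<in> modular_forms (2 * m + 2)"
    by (rule modular_forms_Dop) (use assms m in simp)
  moreover have "n + 1 = int (m + 1)" using m by simp
  ultimately show ?thesis by (simp only: MF_nat) (simp add: m)
qed

section \<open>Graded modules generated over the modular forms\<close>

definition MF_span :: "'i set \<Rightarrow> ('i \<Rightarrow> int) \<Rightarrow> ('i \<Rightarrow> complex \<Rightarrow> complex) \<Rightarrow> int \<Rightarrow> (complex \<Rightarrow> complex) set" where
  "MF_span I d u s = {x. \<exists>c. (\<forall>i\<in>I. c i \<in> MF (s - d i)) \<and> (\<forall>z\<in>uhp. x z = (\<Sum>i\<in>I. c i z * u i z))}"

lemma MF_span_cong:
  assumes "x \<in> MF_span I d u s" "\<And>z. z \<in> uhp \<Longrightarrow> y z = x z"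
  shows "y \<in> MF_span I d u s"
  using assms by (auto simp: MF_span_def)

lemma MF_span_mult:
  assumes "t \<in> MF a" "x \<in> MF_span I d u s"
  shows "(\<lambda>z. t z * x z) \<in> MF_span I d u (a + s)"
proof -
  obtain c where c: "\<forall>i\<in>I. c i \<in> MF (s - d i)" "\<forall>z\<in>uhp. x z = (\<Sum>i\<in>I. c i z * u i z)"
    using assms(2) by (auto simp: MF_span_def)
  have "(\<lambda>z. t z * c i z) \<in> MF (a + s - d i)" if "i \<in> I" for i
    using MF_mult[OF assms(1) c(1)[rule_format, OF that]] by (simp add: algebra_simps)
  then show ?thesis
    using c(2) unfolding MF_span_def
    by (intro CollectI exI[of _ "\<lambda>i z. t z * c i z"]) (auto simp: sum_distrib_left mult.assoc)
qed

lemma MF_span_add: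
  assumes "x \<in> MF_span I d u s" "y \<in> MF_span I d u s"
  shows "(\<lambda>z. x z + y z) \<in> MF_span I d u s"
proof -
  obtain c where c: "\<forall>i\<in>I. c i \<in> MF (s - d i)" "\<forall>z\<in>uhp. x z = (\<Sum>i\<in>I. c i z * u i z)"
    using assms(1) by (auto simp: MF_span_def)
  obtain c' where c': "\<forall>i\<in>I. c' i \<in> MF (s - d i)" "\<forall>z\<in>uhp. y z = (\<Sum>i\<in>I. c' i z * u i z)"
    using assms(2) by (auto simp: MF_span_def)
  show ?thesis
    using c c' unfolding MF_span_def
    by (intro CollectI exI[of _ "\<lambda>i z. c i z + c' i z"]) (auto simp: distrib_right sum.distrib intro: MF_add)
qed

lemma MF_span_zero: "(\<lambda>_. 0) \<in> MF_span I d u s"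
  unfolding MF_span_def by (intro CollectI exI[of _ "\<lambda>_ _. 0"]) (auto intro: MF_zero)

lemma MF_span_sum:
  "(\<And>j. j \<in> A \<Longrightarrow> x j \<in> MF_span I d u s) \<Longrightarrow> (\<lambda>z. \<Sum>j\<in>A. x j z) \<in> MF_span I d u s"
  by (induction A rule: infinite_finite_induct) (auto intro: MF_span_zero MF_span_add)

lemma MF_span_generator:
  assumes "finite I" "i \<in> I"
  shows "u i \<in> MF_span I d u (d i)"
proof -
  have "u i z = (\<Sum>j\<in>I. (if j = i then 1 else 0) * u j z)" for z
    using assms by (simp add: if_distrib[of "\<lambda>x. x * _"] sum.delta cong: if_cong)
  then show ?thesis
    unfolding MF_span_def
    by (intro CollectI exI[of _ "\<lambda>j z. if j = i then 1 else 0"]) (auto intro: MF_zero MF_const)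
qed

lemma MF_span_holomorphic:
  assumes "\<And>i. i \<in> I \<Longrightarrow> u i holomorphic_on uhp" "x \<in> MF_span I d u s"
  shows "x holomorphic_on uhp"
proof -
  obtain c where c: "\<forall>i\<in>I. c i \<in> MF (s - d i)" "\<forall>z\<in>uhp. x z = (\<Sum>i\<in>I. c i z * u i z)"
    using assms(2) by (auto simp: MF_span_def)
  have "(\<lambda>z. \<Sum>i\<in>I. c i z * u i z) holomorphic_on uhp"
    using c(1) assms(1) by (intro holomorphic_intros) (auto intro: MF_holomorphic)
  then show ?thesis by (rule holomorphic_transform) (use c(2) in auto)
qed

text \<open>Leibniz' rule splits the weight: the coefficient takes the even integer part
  \<open>2 * (s - d i)\<close>, for which \<open>Dop\<close> preserves modularity, and the generator
  keeps the real base weight \<open>k\<close>.\<close>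

lemma MF_span_Dop:
  assumes I: "finite I" and hol: "\<And>i. i \<in> I \<Longrightarrow> u i holomorphic_on uhp"
    and D: "\<And>i. i \<in> I \<Longrightarrow> Dop (k + 2 * of_int (d i)) (u i) \<in> MF_span I d u (d i + 1)"
    and x: "x \<in> MF_span I d u s"
  shows "Dop (k + 2 * of_int s) x \<in> MF_span I d u (s + 1)"
proof -
  obtain c where c: "\<And>i. i \<in> I \<Longrightarrow> c i \<in> MF (s - d i)" "\<And>z. z \<in> uhp \<Longrightarrow> x z = (\<Sum>i\<in>I. c i z * u i z)"
    using x by (auto simp: MF_span_def)
  have term_span: "(\<lambda>z. Dop (2 * of_int (s - d i)) (c i) z * u i z + c i z * Dop (k + 2 * of_int (d i)) (u i) z)
      \<in> MF_span I d u (s + 1)" if i: "i \<in> I" for i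
  proof (rule MF_span_add)
    show "(\<lambda>z. Dop (2 * of_int (s - d i)) (c i) z * u i z) \<in> MF_span I d u (s + 1)"
      using MF_span_mult[OF MF_Dop[OF c(1)[OF i]] MF_span_generator[OF I i, of u d]] by (simp add: algebra_simps)
    show "(\<lambda>z. c i z * Dop (k + 2 * of_int (d i)) (u i) z) \<in> MF_span I d u (s + 1)"
      using MF_span_mult[OF c(1)[OF i] D[OF i]] by (simp add: algebra_simps)
  qed
  have "Dop (k + 2 * of_int s) x z =
      (\<Sum>i\<in>I. Dop (2 * of_int (s - d i)) (c i) z * u i z + c i z * Dop (k + 2 * of_int (d i)) (u i) z)"
    if z: "z \<in> uhp" for z
  proof -
    have "Dop (k + 2 * of_int s) x z = Dop (k + 2 * of_int s) (\<lambda>z. \<Sum>i\<in>I. c i z * u i z) z"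
      by (rule Dop_cong[OF c(2) z])
    also have "\<dots> = (\<Sum>i\<in>I. Dop (k + 2 * of_int s) (\<lambda>z. c i z * u i z) z)"
      using MF_holomorphic[OF c(1)] hol by (intro Dop_sum I z holomorphic_on_mult) auto
    also have "\<dots> = (\<Sum>i\<in>I. Dop (2 * of_int (s - d i)) (c i) z * u i z + c i z * Dop (k + 2 * of_int (d i)) (u i) z)"
    proof (rule sum.cong[OF refl])
      fix i assume i: "i \<in> I"
      have eq: "k + 2 * of_int s = 2 * of_int (s - d i) + (k + 2 * of_int (d i))" by simp
      show "Dop (k + 2 * of_int s) (\<lambda>z. c i z * u i z) z =
          Dop (2 * of_int (s - d i)) (c i) z * u i z + c i z * Dop (k + 2 * of_int (d i)) (u i) z"
        unfolding eq by (rule Dop_mult[OF MF_holomorphic[OF c(1)[OF i]] hol[OF i] z])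
    qed
    finally show ?thesis .
  qed
  with MF_span_sum[OF term_span] show ?thesis by (rule MF_span_cong)
qed

text \<open>Degree \<open>s\<close> of the module stands for weight \<open>k + 2 s\<close>. The
  Noetherian property is applied to the coefficient vectors of the iterates of \<open>F\<close>, not
  to the functions, since the generators may be dependent; a relation between the vectors implies
  one between the iterates.\<close>

lemma MF_span_subset_Sigma_set:
  fixes k :: real
  assumes I: "finite I" and hol: "\<And>i. i \<in> I \<Longrightarrow> u i holomorphic_on uhp"
    and D: "\<And>i. i \<in> I \<Longrightarrow> Dop (k + 2 * of_int (d i)) (u i) \<in> MF_span I d u (d i + 1)"
    and F: "F \<in> MF_span I d u s"
  shows "F \<in> Sigma_set (k + 2 * of_int s)"
proof -
  define k' where "k' = k + 2 * of_int s"
  have span: "Diter k' m F \<in> MF_span I d u (s + int m)" for m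
  proof (induction m)
    case (Suc m)
    have "k' + 2 * real m = k + 2 * of_int (s + int m)" by (simp add: k'_def)
    with MF_span_Dop[OF I hol D Suc] show ?case by (simp add: algebra_simps)
  qed (use F in simp)
  then have "\<exists>c. \<forall>m. (\<forall>i\<in>I. c m i \<in> MF (s + int m - d i)) \<and> (\<forall>z\<in>uhp. Diter k' m F z = (\<Sum>i\<in>I. c m i z * u i z))"
    by (intro choice) (simp add: MF_span_def)
  then obtain c where c: "\<And>m i. i \<in> I \<Longrightarrow> c m i \<in> MF (s + int m - d i)"
    "\<And>m z. z \<in> uhp \<Longrightarrow> Diter k' m F z = (\<Sum>i\<in>I. c m i z * u i z)"
    by blast
  obtain e where e: "bij_betw e {..<card I} I"
    using ex_bij_betw_nat_finite[OF I] by (auto simp: atLeast0LessThan)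
  have "c m (e i) \<in> MF (s + int m - d (e i))" if "i < card I" for m i
    using c(1) e that by (auto simp: bij_betw_def)
  from MF_noetherian[of "card I" "\<lambda>m i. c m (e i)" "\<lambda>m. s + int m" "\<lambda>i. d (e i)", OF this]
  obtain m t where t: "\<And>j. j < m \<Longrightarrow> t j \<in> MF (s + int m - (s + int j))"
    "\<And>i z. i < card I \<Longrightarrow> z \<in> uhp \<Longrightarrow> c m (e i) z = (\<Sum>j<m. t j z * c j (e i) z)" by blast
  have rel: "Diter k' m F z = (\<Sum>j<m. t j z * Diter k' j F z)" if z: "z \<in> uhp" for z
  proof -
    have "c m i z = (\<Sum>j<m. t j z * c j i z)" if "i \<in> I" for i
    proof -
      obtain l where "l < card I" "i = e l" using \<open>i \<in> I\<close> e unfolding bij_betw_def by blast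
      then show ?thesis using t(2)[OF _ z] by simp
    qed
    then have "Diter k' m F z = (\<Sum>i\<in>I. (\<Sum>j<m. t j z * c j i z) * u i z)"
      unfolding c(2)[OF z] by (intro sum.cong) auto
    also have "\<dots> = (\<Sum>j<m. \<Sum>i\<in>I. t j z * c j i z * u i z)"
      unfolding sum_distrib_right by (rule sum.swap)
    also have "\<dots> = (\<Sum>j<m. t j z * Diter k' j F z)"
      unfolding c(2)[OF z] by (simp add: sum_distrib_left mult.assoc)
    finally show ?thesis .
  qed
  have "satisfies_monic_MLDE k' F"
    unfolding satisfies_monic_MLDE_def
  proof (intro exI conjI ballI)
    fix i assume i: "i \<in> {1..m}"
    then have "t (m - i) \<in> MF (int i)" using t(1)[of "m - i"] by (simp add: of_nat_diff)
    then show "(\<lambda>z. - t (m - i) z) \<in> modular_forms (2 * i)" using MF_minus by fastforce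
  next
    fix z assume z: "z \<in> uhp"
    have "(\<Sum>i = 1..m. - t (m - i) z * Diter k' (m - i) F z) = (\<Sum>j<m. - t j z * Diter k' j F z)"
      by (rule sum.reindex_bij_witness[of _ "\<lambda>j. m - j" "\<lambda>i. m - i"]) auto
    then show "Diter k' m F z + (\<Sum>i = 1..m. - t (m - i) z * Diter k' (m - i) F z) = 0"
      unfolding rel[OF z] by (simp add: sum_negf)
  qed
  then show ?thesis
    using MF_span_holomorphic[OF hol F] by (simp add: Sigma_set_def k'_def)
qed

lemma holomorphic_on_Diter: "f holomorphic_on uhp \<Longrightarrow> Diter k j f holomorphic_on uhp"
  by (induction j) (simp_all add: holomorphic_on_Dop)

text \<open>The functions \<open>1\<close> and \<open>log q\<close> solve \<open>D\<^sub>1 (D\<^sub>-\<^sub>1 a) = - E\<^sub>4 / 144 * a\<close>, and \<open>E\<^sub>2 / 12\<close> is \<open>D\<^sub>-\<^sub>1 1\<close>.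
  Multiplying a solution of an MLDE by such a pair \<open>a\<close>, \<open>b = D\<^sub>-\<^sub>1 a\<close> stays in a finitely generated module.\<close>

lemma Sigma_set_times_pair:
  assumes f: "f \<in> Sigma_set k"
    and a: "a holomorphic_on uhp" and b: "b holomorphic_on uhp"
    and Da: "\<And>z. z \<in> uhp \<Longrightarrow> Dop (- 1) a z = b z"
    and Db: "\<And>z. z \<in> uhp \<Longrightarrow> Dop 1 b z = - 1 / 144 * E4 z * a z"
  shows "(\<lambda>z. a z * f z) \<in> Sigma_set (k - 1)" "(\<lambda>z. b z * f z) \<in> Sigma_set (k + 1)"
proof -
  have fhol: "f holomorphic_on uhp" using f by (simp add: Sigma_set_def)
  obtain n g where g: "\<And>i. i \<in> {1..n} \<Longrightarrow> g i \<in> modular_forms (2 * i)"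
    "\<And>z. z \<in> uhp \<Longrightarrow> Diter k n f z + (\<Sum>i = 1..n. g i z * Diter k (n - i) f z) = 0"
    using f unfolding Sigma_set_def satisfies_monic_MLDE_def by blast
  define \<phi> where "\<phi> = (\<lambda>j. Diter k j f)"
  have \<phi>: "\<phi> j holomorphic_on uhp" for j unfolding \<phi>_def by (rule holomorphic_on_Diter[OF fhol])
  define p where "p = (\<lambda>e::nat. if e = 0 then a else b)"
  have p: "p e holomorphic_on uhp" for e using a b by (simp add: p_def)
  define I where "I = {..<n} \<times> {..<2::nat}"
  \<comment> \<open>Degrees are relative to the base weight \<open>k - 1\<close>: each Serre
    derivative of \<open>f\<close> adds one, and so does passing from \<open>a\<close>, of weight
    -1, to \<open>b\<close>, of weight 1.\<close>
  define d where "d = (\<lambda>(j::nat, e::nat). int (j + e))"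
  define u where "u = (\<lambda>(j, e) z. p e z * \<phi> j z)"
  have I: "finite I" by (simp add: I_def)
  have gen: "(\<lambda>z. p e z * \<phi> j z) \<in> MF_span I d u (int (j + e))" if "j < n" "e < 2" for j e
  proof -
    have "(j, e) \<in> I" using that by (simp add: I_def)
    moreover have "u (j, e) = (\<lambda>z. p e z * \<phi> j z)" "d (j, e) = int (j + e)" by (simp_all add: u_def d_def)
    ultimately show ?thesis using MF_span_generator[OF I, of "(j, e)" u d] by (simp only:)
  qed
  have span: "(\<lambda>z. p e z * \<phi> j z) \<in> MF_span I d u (int (j + e))" if "j \<le> n" "e < 2" for j e
  proof (cases "j < n")
    case True
    then show ?thesis using gen that by blast
  next
    case False
    then have j: "j = n" using that by simp
    \<comment> \<open>At \<open>j = n\<close> the equation of \<open>f\<close> rewrites the iterate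
      by lower ones; this closes the module under \<open>Dop\<close>.\<close>
    have "(\<lambda>z. - g i z * (p e z * \<phi> (n - i) z)) \<in> MF_span I d u (int (n + e))" if i: "i \<in> {1..n}" for i
    proof -
      have "(\<lambda>z. p e z * \<phi> (n - i) z) \<in> MF_span I d u (int (n - i + e))"
        using i \<open>e < 2\<close> by (intro gen) auto
      moreover have "(\<lambda>z. - g i z) \<in> MF (int i)" using MF_minus[of "g i" "int i"] g(1)[OF i] by simp
      ultimately have "(\<lambda>z. - g i z * (p e z * \<phi> (n - i) z)) \<in> MF_span I d u (int i + int (n - i + e))"
        by (intro MF_span_mult)
      moreover have "int i + int (n - i + e) = int (n + e)" using i by simp
      ultimately show ?thesis by (simp only:)
    qed
    from MF_span_sum[of "{1..n}" "\<lambda>i z. - g i z * (p e z * \<phi> (n - i) z)", OF this]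
    have "(\<lambda>z. p e z * \<phi> j z) \<in> MF_span I d u (int (n + e))"
    proof (rule MF_span_cong)
      fix z assume "z \<in> uhp"
      then have "\<phi> n z = (\<Sum>i = 1..n. - g i z * \<phi> (n - i) z)"
        using g(2)[of z] by (simp add: \<phi>_def sum_negf eq_neg_iff_add_eq_0)
      then show "p e z * \<phi> j z = (\<Sum>i = 1..n. - g i z * (p e z * \<phi> (n - i) z))"
        by (simp add: j sum_distrib_left mult_ac)
    qed
    then show ?thesis by (simp only: j)
  qed
  have D\<phi>: "Dop (k + 2 * real j) (\<phi> j) = \<phi> (Suc j)" for j by (simp add: \<phi>_def)
  have DI: "Dop (k - 1 + 2 * of_int (d i)) (u i) \<in> MF_span I d u (d i + 1)" if iI: "i \<in> I" for i
  proof -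
    obtain j e where i: "i = (j, e)" "j < n" "e < 2" using iI by (auto simp: I_def)
    consider "e = 0" | "e = 1" using i(3) by linarith
    then show ?thesis
    proof cases
      case 1
      have "(\<lambda>z. p 1 z * \<phi> j z + p 0 z * \<phi> (Suc j) z) \<in> MF_span I d u (int j + 1)"
        using span[of j 1] span[of "Suc j" 0] i by (intro MF_span_add) (simp_all add: add.commute)
      then have "Dop (k - 1 + 2 * of_int (d i)) (u i) \<in> MF_span I d u (int j + 1)"
      proof (rule MF_span_cong)
        fix z assume z: "z \<in> uhp"
        have "Dop (- 1 + (k + 2 * real j)) (\<lambda>z. a z * \<phi> j z) z = b z * \<phi> j z + a z * \<phi> (Suc j) z"
          unfolding Dop_mult[OF a \<phi> z] Da[OF z] D\<phi> ..
        then show "Dop (k - 1 + 2 * of_int (d i)) (u i) z = p 1 z * \<phi> j z + p 0 z * \<phi> (Suc j) z"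
          by (simp add: i 1 d_def u_def p_def algebra_simps)
      qed
      then show ?thesis by (simp add: i 1 d_def)
    next
      case 2
      have E: "(\<lambda>z. - 1 / 144 * E4 z) \<in> MF 2"
        using MF_cmult[of E4 2 "- 1 / 144"] E4_modular MF_nat[of 2] by simp
      have "(\<lambda>z. (- 1 / 144 * E4 z) * (p 0 z * \<phi> j z) + p 1 z * \<phi> (Suc j) z) \<in> MF_span I d u (int j + 2)"
        using MF_span_mult[OF E span[of j 0]] span[of "Suc j" 1] i
        by (intro MF_span_add) (simp_all add: add.commute)
      then have "Dop (k - 1 + 2 * of_int (d i)) (u i) \<in> MF_span I d u (int j + 2)"
      proof (rule MF_span_cong)
        fix z assume z: "z \<in> uhp"
        have "Dop (1 + (k + 2 * real j)) (\<lambda>z. b z * \<phi> j z) z = - 1 / 144 * E4 z * a z * \<phi> j z + b z * \<phi> (Suc j) z"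
          unfolding Dop_mult[OF b \<phi> z] Db[OF z] D\<phi> ..
        then show "Dop (k - 1 + 2 * of_int (d i)) (u i) z = (- 1 / 144 * E4 z) * (p 0 z * \<phi> j z) + p 1 z * \<phi> (Suc j) z"
          by (simp add: i 2 d_def u_def p_def algebra_simps)
      qed
      then show ?thesis by (simp add: i 2 d_def add.commute)
    qed
  qed
  have hu: "u i holomorphic_on uhp" if "i \<in> I" for i
  proof -
    obtain j e where "i = (j, e)" by fastforce
    moreover have "(\<lambda>z. p e z * \<phi> j z) holomorphic_on uhp" by (intro holomorphic_on_mult p \<phi>)
    ultimately show ?thesis by (simp add: u_def)
  qed
  \<comment> \<open>Using \<open>span\<close> instead of \<open>gen\<close> covers the order
    \<open>n = 0\<close> as well, where \<open>I\<close> is empty and \<open>f\<close>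
    vanishes.\<close>
  have "(\<lambda>z. p 0 z * \<phi> 0 z) \<in> Sigma_set (k - 1 + 2 * of_int (int (0 + 0)))"
    "(\<lambda>z. p 1 z * \<phi> 0 z) \<in> Sigma_set (k - 1 + 2 * of_int (int (0 + 1)))"
    by (rule MF_span_subset_Sigma_set[OF I hu DI span]; simp)+
  then have "(\<lambda>z. p 0 z * \<phi> 0 z) \<in> Sigma_set (k - 1)" "(\<lambda>z. p 1 z * \<phi> 0 z) \<in> Sigma_set (k + 1)"
    by (simp_all add: algebra_simps)
  then show "(\<lambda>z. a z * f z) \<in> Sigma_set (k - 1)" "(\<lambda>z. b z * f z) \<in> Sigma_set (k + 1)"
    by (simp_all add: p_def \<phi>_def)
qed

text \<open>The two equations may have different orders, so the iterates of both functions are taken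
  together as generators, each family up to its own order, and the sum lies in degree 0.\<close>

lemma Sigma_set_add:
  assumes "f \<in> Sigma_set k" "h \<in> Sigma_set k"
  shows "(\<lambda>z. f z + h z) \<in> Sigma_set k"
proof -
  define F where "F = (\<lambda>e::nat. if e = 0 then f else h)"
  have F: "F e \<in> Sigma_set k" for e using assms by (simp add: F_def)
  have "\<forall>e. \<exists>n g. (\<forall>i\<in>{1..n}. g i \<in> modular_forms (2 * i)) \<and>
      (\<forall>z\<in>uhp. Diter k n (F e) z + (\<Sum>i = 1..n. g i z * Diter k (n - i) (F e) z) = 0)"
    using F unfolding Sigma_set_def satisfies_monic_MLDE_def by blast
  then have "\<exists>n g. \<forall>e. (\<forall>i\<in>{1..n e}. g e i \<in> modular_forms (2 * i)) \<and>
      (\<forall>z\<in>uhp. Diter k (n e) (F e) z + (\<Sum>i = 1..n e. g e i z * Diter k (n e - i) (F e) z) = 0)"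
    unfolding choice_iff .
  then obtain n g where g: "\<And>e i. i \<in> {1..n e} \<Longrightarrow> g e i \<in> modular_forms (2 * i)"
    "\<And>e z. z \<in> uhp \<Longrightarrow> Diter k (n e) (F e) z + (\<Sum>i = 1..n e. g e i z * Diter k (n e - i) (F e) z) = 0"
    by blast
  define I where "I = (SIGMA e:{..<2::nat}. {..<n e})"
  define d where "d = (\<lambda>(e::nat, j::nat). int j)"
  define u where "u = (\<lambda>(e, j). Diter k j (F e))"
  have I: "finite I" by (simp add: I_def)
  have gen: "Diter k j (F e) \<in> MF_span I d u (int j)" if "e < 2" "j < n e" for e j
    using MF_span_generator[OF I, of "(e, j)" u d] that by (simp add: I_def u_def d_def)
  have span: "Diter k j (F e) \<in> MF_span I d u (int j)" if "e < 2" "j \<le> n e" for e j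
  proof (cases "j < n e")
    case False
    then have j: "j = n e" using that by simp
    have "(\<lambda>z. - g e i z * Diter k (n e - i) (F e) z) \<in> MF_span I d u (int (n e))" if i: "i \<in> {1..n e}" for i
    proof -
      have "Diter k (n e - i) (F e) \<in> MF_span I d u (int (n e - i))"
        using i \<open>e < 2\<close> by (intro gen) auto
      moreover have "(\<lambda>z. - g e i z) \<in> MF (int i)" using MF_minus[of "g e i" "int i"] g(1)[OF i] by simp
      ultimately have "(\<lambda>z. - g e i z * Diter k (n e - i) (F e) z) \<in> MF_span I d u (int i + int (n e - i))"
        by (intro MF_span_mult)
      moreover have "int i + int (n e - i) = int (n e)" using i by simp
      ultimately show ?thesis by (simp only:)
    qed
    from MF_span_sum[of "{1..n e}" "\<lambda>i z. - g e i z * Diter k (n e - i) (F e) z", OF this] show ?thesis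
      unfolding j
    proof (rule MF_span_cong)
      fix z assume "z \<in> uhp"
      then show "Diter k (n e) (F e) z = (\<Sum>i = 1..n e. - g e i z * Diter k (n e - i) (F e) z)"
        using g(2)[of z e] by (simp add: sum_negf eq_neg_iff_add_eq_0)
    qed
  qed (use gen that in auto)
  have hol: "F e holomorphic_on uhp" for e using F[of e] by (simp add: Sigma_set_def)
  have "(\<lambda>z. f z + h z) \<in> MF_span I d u 0"
    using span[of 0 0] span[of 1 0] by (intro MF_span_add) (simp_all add: F_def)
  moreover have "Dop (k + 2 * of_int (d i)) (u i) \<in> MF_span I d u (d i + 1)" if iI: "i \<in> I" for i
  proof -
    obtain e j where i: "i = (e, j)" "e < 2" "j < n e" using iI by (auto simp: I_def)
    show ?thesis using span[of e "Suc j"] i by (simp add: u_def d_def add.commute)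
  qed
  moreover have "u i holomorphic_on uhp" if "i \<in> I" for i
    by (cases i) (simp add: u_def holomorphic_on_Diter hol)
  ultimately have "(\<lambda>z. f z + h z) \<in> Sigma_set (k + 2 * of_int 0)"
    using I by (intro MF_span_subset_Sigma_set) auto
  then show ?thesis by simp
qed

section \<open>The four inclusions\<close>

lemma Sigma_set_diff_nat:
  assumes step: "\<And>k. Sigma_set k \<subseteq> Sigma_set (k - 1)"
  shows "Sigma_set (k + real n) \<subseteq> Sigma_set k"
proof (induction n)
  case (Suc n)
  have "k + real (Suc n) - 1 = k + real n" by simp
  then show ?case using step[of "k + real (Suc n)"] Suc by simp
qed simp

lemma E2_holomorphic: "E2 holomorphic_on uhp"
  by (rule qexp_holomorphic[OF qexp_E2])

text \<open>The pair is \<open>c\<close> and \<open>c * E2 / 12\<close>; \<open>c = 1\<close> will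
  give the lowering of the weight, \<open>c = 12\<close> the multiplication by
  \<open>E2\<close>.\<close>

lemma Sigma_set_times_const:
  assumes "f \<in> Sigma_set k"
  shows "(\<lambda>z. c * f z) \<in> Sigma_set (k - 1)" "(\<lambda>z. c / 12 * E2 z * f z) \<in> Sigma_set (k + 1)"
proof -
  have D: "Dop 1 (\<lambda>z. c / 12 * E2 z) z = - 1 / 144 * E4 z * c" if z: "z \<in> uhp" for z
  proof -
    have "deriv (\<lambda>z. c / 12 * E2 z) z = c / 12 * deriv E2 z"
      by (intro DERIV_imp_deriv DERIV_cmult holomorphic_uhp_deriv E2_holomorphic z)
    then show ?thesis by (simp add: Dop_def qderiv_def E4_def field_simps)
  qed
  have b: "(\<lambda>z. c / 12 * E2 z) holomorphic_on uhp"
    by (intro holomorphic_intros E2_holomorphic)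
  have D': "Dop (- 1) (\<lambda>_. c) z = c / 12 * E2 z" for z
    by (simp add: Dop_def qderiv_def)
  show "(\<lambda>z. c * f z) \<in> Sigma_set (k - 1)" "(\<lambda>z. c / 12 * E2 z * f z) \<in> Sigma_set (k + 1)"
    by (rule Sigma_set_times_pair[OF assms holomorphic_on_const b D' D]; assumption)+
qed

text \<open>As the normalized derivative of \<open>log q\<close> is 1, the partner of
  \<open>log q\<close> is \<open>1 + E2 / 12 * log q\<close>.\<close>

lemma Sigma_set_times_log:
  assumes "f \<in> Sigma_set k"
  shows "(\<lambda>z. (2 * of_real pi * \<i> * z) * f z) \<in> Sigma_set (k - 1)"
proof (rule Sigma_set_times_pair(1)[OF assms])
  define P where "P = 2 * complex_of_real pi * \<i>"
  have P: "P \<noteq> 0" by (simp add: P_def)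
  show "(\<lambda>z. 2 * of_real pi * \<i> * z) holomorphic_on uhp" by (intro holomorphic_intros)
  show "(\<lambda>z. 1 + E2 z / 12 * (2 * of_real pi * \<i> * z)) holomorphic_on uhp"
    by (intro holomorphic_intros E2_holomorphic) auto
  fix z assume z: "z \<in> uhp"
  have "deriv (\<lambda>z. P * z) z = P" by (intro DERIV_imp_deriv) (auto intro!: derivative_eq_intros)
  then show "Dop (- 1) (\<lambda>z. 2 * of_real pi * \<i> * z) z = 1 + E2 z / 12 * (2 * of_real pi * \<i> * z)"
    unfolding P_def[symmetric] using P by (simp add: Dop_def qderiv_def P_def[symmetric])
  have D: "deriv (\<lambda>z. 1 + E2 z / 12 * (P * z)) z = deriv E2 z / 12 * (P * z) + E2 z / 12 * P"
    by (intro DERIV_imp_deriv) (auto intro!: derivative_eq_intros holomorphic_uhp_deriv[OF E2_holomorphic z])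
  show "Dop 1 (\<lambda>z. 1 + E2 z / 12 * (2 * of_real pi * \<i> * z)) z = - 1 / 144 * E4 z * (2 * of_real pi * \<i> * z)"
    unfolding P_def[symmetric] Dop_def qderiv_def E4_def D using P by (simp add: field_simps)
qed

theorem theorem4p4:
  fixes k l :: real
  shows "Sigma_set k \<subseteq> Sigma_set (k - 1) \<and>
    (\<lambda>f. (\<lambda>z. (2 * of_real pi * \<i> * z) * f z)) ` Sigma_set k \<subseteq> Sigma_set (k - 1) \<and>
    (\<lambda>f. (\<lambda>z. E2 z * f z)) ` Sigma_set k \<subseteq> Sigma_set (k + 1) \<and>
    (k - l \<in> \<int> \<longrightarrow>
      {(\<lambda>z. f z + g z) | f g. f \<in> Sigma_set k \<and> g \<in> Sigma_set l} \<subseteq> Sigma_set (min k l))"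
proof (intro conjI impI)
  have step: "Sigma_set k \<subseteq> Sigma_set (k - 1)" for k
    using Sigma_set_times_const(1)[where c = 1] by auto
  show "Sigma_set k \<subseteq> Sigma_set (k - 1)" by (rule step)
  show "(\<lambda>f. (\<lambda>z. (2 * of_real pi * \<i> * z) * f z)) ` Sigma_set k \<subseteq> Sigma_set (k - 1)"
    using Sigma_set_times_log by blast
  show "(\<lambda>f. (\<lambda>z. E2 z * f z)) ` Sigma_set k \<subseteq> Sigma_set (k + 1)"
    using Sigma_set_times_const(2)[where c = 12] by auto
  assume "k - l \<in> \<int>"
  then obtain n :: int where n: "k - l = of_int n" by (auto elim: Ints_cases)
  \<comment> \<open>Truncation by \<open>nat\<close> makes the shift 0 for the smaller weight and
    the absolute difference for the larger one.\<close>
  have "k = min k l + real (nat n)" "l = min k l + real (nat (- n))"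
    using n by (auto simp: min_def split: if_splits)
  then have "Sigma_set k \<subseteq> Sigma_set (min k l)" "Sigma_set l \<subseteq> Sigma_set (min k l)"
    using Sigma_set_diff_nat[OF step] by metis+
  then show "{(\<lambda>z. f z + g z) | f g. f \<in> Sigma_set k \<and> g \<in> Sigma_set l} \<subseteq> Sigma_set (min k l)"
    using Sigma_set_add by blast
qed

end
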